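(* Let $c$ be a variance $1$ circular element, let $I$ be a countable index set, let $n\ge 0$, and let $T\in\mathcal{H}^{(n)}(c,I)$. Then \[ \|T\|\le\sqrt{e}\,\sqrt{n+1}\,\|T\|_2 . \]
   Context: A $C^\ast$-probability space $(\mathscr{A},\phi)$ is a unital $C^\ast$-algebra with a faithful state; $\|\cdot\|$ is the $C^\ast$-norm and $\|x\|_2=\phi(xx^\ast)^{1/2}$. A (variance $1$) circular element $c\in\mathscr{A}$ is one with the $\ast$-distribution of $(s_1+\sqrt{-1}\,s_2)/\sqrt2$, where $s_1,s_2$ are free semicircular elements with density $\frac1{2\pi}\sqrt{4-t^2}\,dt$ on $[-2,2]$; equivalently, among all free cumulants with arguments in $\{c,c^\ast\}$ the only non-zero ones are $\kappa_2[c,c^\ast]=\kappa_2[c^\ast,c]=1$. Let $\{c_i:i\in I\}$ be $\ast$-free circular elements of variance $1$ in a $C^\ast$-probability space $(\mathscr{A},\phi)$. For $\mathbf{i}=(i_1,\dots,i_n)\in I^n$ put $c_{\mathbf{i}}=c_{i_1}\cdots c_{i_n}$ (the empty product is $1$). The $n$-particle space $\mathcal{H}^{(n)}(c,I)$ is the Hilbert subspace ($\|\cdot\|_2$-closed) of all elements $T=\sum_{\mathbf{i}\in I^n}\lambda_{\mathbf{i}}c_{\mathbf{i}}$, $\lambda_{\mathbf{i}}\in\mathbb{C}$, with $\|T\|_2<\infty$. For sums with infinitely many terms the inequality is understood to include that $T$ is (identified with) an element of the norm closure of the finite sums. *)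

theory Defs
  imports "HOL-Analysis.Analysis"
begin

text \<open>Complex unital C*-algebras, as a class of types. The axiom \<open>norm 1 = 1\<close>
  inherited from \<^class>\<open>real_normed_algebra_1\<close> only excludes the zero algebra,
  which carries no state.\<close>

class cstar_algebra = real_normed_algebra_1 + banach +
  fixes scaleC :: "complex \<Rightarrow> 'a \<Rightarrow> 'a" (infixr "*\<^sub>C" 75)
    and star :: "'a \<Rightarrow> 'a"
  assumes scaleR_scaleC: "scaleR r x = complex_of_real r *\<^sub>C x"
    and scaleC_add_right: "a *\<^sub>C (x + y) = a *\<^sub>C x + a *\<^sub>C y"
    and scaleC_add_left: "(a + b) *\<^sub>C x = a *\<^sub>C x + b *\<^sub>C x"
    and scaleC_scaleC: "a *\<^sub>C (b *\<^sub>C x) = (a * b) *\<^sub>C x"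
    and scaleC_one: "1 *\<^sub>C x = x"
    and mult_scaleC_left: "(a *\<^sub>C x) * y = a *\<^sub>C (x * y)"
    and mult_scaleC_right: "x * (a *\<^sub>C y) = a *\<^sub>C (x * y)"
    and norm_scaleC: "norm (a *\<^sub>C x) = cmod a * norm x"
    and star_add: "star (x + y) = star x + star y"
    and star_scaleC: "star (a *\<^sub>C x) = cnj a *\<^sub>C star x"
    and star_mult: "star (x * y) = star y * star x"
    and star_star: "star (star x) = x"
    and cstar_identity: "norm (star x * x) = (norm x)\<^sup>2"

definition faithful_state :: "('a::cstar_algebra \<Rightarrow> complex) \<Rightarrow> bool" where
  "faithful_state \<phi> \<longleftrightarrow>
     (\<forall>x y. \<phi> (x + y) = \<phi> x + \<phi> y) \<and>
     (\<forall>a x. \<phi> (a *\<^sub>C x) = a * \<phi> x) \<and>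
     \<phi> 1 = 1 \<and>
     (\<forall>x. \<phi> (star x * x) \<in> \<real>\<^sub>\<ge>\<^sub>0) \<and>
     (\<forall>x. \<phi> (star x * x) = 0 \<longrightarrow> x = 0)"

definition norm2 :: "('a::cstar_algebra \<Rightarrow> complex) \<Rightarrow> 'a \<Rightarrow> real" where
  "norm2 \<phi> x = sqrt (Re (\<phi> (x * star x)))"

inductive_set star_subalgebra :: "'a::cstar_algebra set \<Rightarrow> 'a set" for S where
  one: "1 \<in> star_subalgebra S"
| gen: "x \<in> S \<Longrightarrow> x \<in> star_subalgebra S"
| add: "x \<in> star_subalgebra S \<Longrightarrow> y \<in> star_subalgebra S \<Longrightarrow> x + y \<in> star_subalgebra S"
| mult: "x \<in> star_subalgebra S \<Longrightarrow> y \<in> star_subalgebra S \<Longrightarrow> x * y \<in> star_subalgebra S"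
| scale: "x \<in> star_subalgebra S \<Longrightarrow> a *\<^sub>C x \<in> star_subalgebra S"
| star: "x \<in> star_subalgebra S \<Longrightarrow> star x \<in> star_subalgebra S"

definition free_subalgebras ::
  "('a::cstar_algebra \<Rightarrow> complex) \<Rightarrow> 'i set \<Rightarrow> ('i \<Rightarrow> 'a set) \<Rightarrow> bool" where
  "free_subalgebras \<phi> I A \<longleftrightarrow>
     (\<forall>ks xs. ks \<noteq> [] \<and> set ks \<subseteq> I \<and> distinct_adj ks \<and> length xs = length ks \<and>
        (\<forall>j<length ks. xs ! j \<in> A (ks ! j) \<and> \<phi> (xs ! j) = 0)
        \<longrightarrow> \<phi> (prod_list xs) = 0)"

definition star_free ::
  "('a::cstar_algebra \<Rightarrow> complex) \<Rightarrow> 'i set \<Rightarrow> ('i \<Rightarrow> 'a) \<Rightarrow> bool" where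
  "star_free \<phi> I c \<longleftrightarrow> free_subalgebras \<phi> I (\<lambda>i. star_subalgebra {c i})"

text \<open>The *-distribution is the family of *-moments, indexed by words in two letters:
  \<open>False\<close> stands for the element and \<open>True\<close> for its adjoint.\<close>

definition star_distribution ::
  "('a::cstar_algebra \<Rightarrow> complex) \<Rightarrow> 'a \<Rightarrow> bool list \<Rightarrow> complex" where
  "star_distribution \<phi> x w = \<phi> (prod_list (map (\<lambda>b. if b then star x else x) w))"

text \<open>The law of a self-adjoint element is compactly supported, hence determined by
  its moments.\<close>

definition semicircular :: "('a::cstar_algebra \<Rightarrow> complex) \<Rightarrow> 'a \<Rightarrow> bool" where
  "semicircular \<phi> s \<longleftrightarrow> star s = s \<and>
     (\<forall>k. \<phi> (s ^ k) =
        complex_of_real (integral {-2..2} (\<lambda>t. t ^ k * (1 / (2 * pi) * sqrt (4 - t\<^sup>2)))))"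

text \<open>Circular of variance 1. It is no restriction to take \<open>s1\<close> and \<open>s2\<close> in the same
  space as \<open>c\<close>: if \<open>c\<close> has this *-distribution, then \<open>(c + c*)/sqrt 2\<close> and
  \<open>(c - c*)/(i sqrt 2)\<close> are free semicircular elements. As these are self-adjoint,
  freeness of \<open>s1, s2\<close> and *-freeness coincide.\<close>

definition circular :: "('a::cstar_algebra \<Rightarrow> complex) \<Rightarrow> 'a \<Rightarrow> bool" where
  "circular \<phi> c \<longleftrightarrow>
     (\<exists>s1 s2. semicircular \<phi> s1 \<and> semicircular \<phi> s2 \<and>
        star_free \<phi> UNIV (case_bool s1 s2) \<and>
        star_distribution \<phi> c =
          star_distribution \<phi> (complex_of_real (1 / sqrt 2) *\<^sub>C (s1 + \<i> *\<^sub>C s2)))"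

definition index_words :: "nat \<Rightarrow> 'i set \<Rightarrow> 'i list set" where
  "index_words n I = {w. length w = n \<and> set w \<subseteq> I}"

definition word_prod :: "('i \<Rightarrow> 'a::cstar_algebra) \<Rightarrow> 'i list \<Rightarrow> 'a" where
  "word_prod c w = prod_list (map c w)"

definition finite_sums :: "nat \<Rightarrow> ('i \<Rightarrow> 'a::cstar_algebra) \<Rightarrow> 'i set \<Rightarrow> 'a set" where
  "finite_sums n c I =
     {(\<Sum>w\<in>F. a w *\<^sub>C word_prod c w) | F a. finite F \<and> F \<subseteq> index_words n I}"

text \<open>\<open>\<Lambda>\<close> exhibits the Hilbert space \<open>'h\<close> as the completion of the algebra with respect
  to \<^const>\<open>norm2\<close>; it is unique up to unique isometric isomorphism. Only the real
  Hilbert space structure of \<open>'h\<close> is recorded: multiplication by complex scalars is the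
  unique continuous extension of \<open>\<Lambda> x \<mapsto> \<Lambda> (a *\<^sub>C x)\<close>.\<close>

definition L2_completion ::
  "('a::cstar_algebra \<Rightarrow> complex) \<Rightarrow> ('a \<Rightarrow> 'h::{real_inner, complete_space}) \<Rightarrow> bool" where
  "L2_completion \<phi> \<Lambda> \<longleftrightarrow>
     linear \<Lambda> \<and> (\<forall>x. norm (\<Lambda> x) = norm2 \<phi> x) \<and> closure (range \<Lambda>) = UNIV"

text \<open>Possibly infinite sums \<open>\<Sum>w. a w c_w\<close> converging in 2-norm. For *-free circular
  \<open>c i\<close> the \<open>c_w\<close> are orthonormal, so this is the closed linear span of the \<open>c_w\<close>.\<close>

definition particle_space ::
  "('a::cstar_algebra \<Rightarrow> 'h::{real_inner, complete_space}) \<Rightarrow> nat \<Rightarrow> ('i \<Rightarrow> 'a) \<Rightarrow> 'i set \<Rightarrow> 'h set"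
  where
  "particle_space \<Lambda> n c I =
     {T. \<exists>a. ((\<lambda>w. \<Lambda> (a w *\<^sub>C word_prod c w)) has_sum T) (index_words n I)}"

end

theory Submission
  imports Defs
begin

text \<open>The Wick products of words in the letters \<open>c i\<close>, \<open>star (c i)\<close> are orthonormal in \<open>L\<^sup>2\<close>,
  and left multiplication by \<open>c i\<close> creates one letter and annihilates the opposite one. So
  \<open>T = \<Sum>r. \<alpha> r c_r\<close> over words \<open>r\<close> of length \<open>n\<close> maps a coefficient family \<open>\<beta>\<close> to
  \<open>w \<mapsto> \<Sum>k\<le>n. \<Sum>v. \<alpha> (u v) \<beta> (v\<^sup>* y)\<close>, where \<open>u\<close> is the prefix of length \<open>k\<close> of \<open>w = u y\<close> and has
  to consist of unstarred letters. A weighted Cauchy--Schwarz inequality bounds this operator by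
  \<open>(\<rho>\<^sup>n (1 - \<rho>))\<^sup>-\<^sup>1 \<Sum>r. |\<alpha> r|\<^sup>2\<close> for every \<open>0 < \<rho> < 1\<close>: the \<open>k\<close>-th term gets weight
  \<open>\<rho>\<^sup>k\<close>, times \<open>1 - \<rho>\<close> if \<open>y\<close> still begins with an unstarred letter. These weights come from
  the Perron vector of the product of \<open>n\<close> free circular elements with distinct indices, which is
  the extremal case. As the state is faithful, this bound on all moments of \<open>T\<^sup>* T\<close> is a bound on
  the norm, and infinite sums follow by completeness.\<close>

subsection \<open>Square roots in C*-algebras\<close>

lemma scaleC_zero_right [simp]: "a *\<^sub>C (0::'a::cstar_algebra) = 0"
  using scaleC_add_right[of a 0 "0::'a"] by simp

lemma scaleC_zero_left [simp]: "0 *\<^sub>C (x::'a::cstar_algebra) = 0"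
  using scaleC_add_left[of 0 0 x] by simp

lemma scaleC_minus_left: "(- a) *\<^sub>C (x::'a::cstar_algebra) = - (a *\<^sub>C x)"
  using scaleC_add_left[of "-a" a x] by (simp add: eq_neg_iff_add_eq_0)

lemma scaleC_minus_right: "a *\<^sub>C (- x::'a::cstar_algebra) = - (a *\<^sub>C x)"
  using scaleC_add_right[of a "-x" x] by (simp add: eq_neg_iff_add_eq_0)

lemma scaleC_diff_right: "a *\<^sub>C (x - y::'a::cstar_algebra) = a *\<^sub>C x - a *\<^sub>C y"
  using scaleC_add_right[of a x "-y"] by (simp add: scaleC_minus_right)

lemma scaleC_diff_left: "(a - b) *\<^sub>C (x::'a::cstar_algebra) = a *\<^sub>C x - b *\<^sub>C x"
  using scaleC_add_left[of a "-b" x] by (simp add: scaleC_minus_left)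

lemma scaleC_sum_right: "a *\<^sub>C sum f S = (\<Sum>i\<in>S. a *\<^sub>C (f i::'a::cstar_algebra))"
  by (induction S rule: infinite_finite_induct) (simp_all add: scaleC_add_right)

lemma scaleC_sum_left: "sum f S *\<^sub>C (x::'a::cstar_algebra) = (\<Sum>i\<in>S. f i *\<^sub>C x)"
  by (induction S rule: infinite_finite_induct) (simp_all add: scaleC_add_left)

lemma star_zero [simp]: "star (0::'a::cstar_algebra) = 0"
  using star_add[of 0 "0::'a"] by simp

lemma star_minus: "star (- x::'a::cstar_algebra) = - star x"
  using star_add[of "-x" x] by (simp add: eq_neg_iff_add_eq_0)

lemma star_diff: "star (x - y::'a::cstar_algebra) = star x - star y"
  using star_add[of x "-y"] by (simp add: star_minus)

lemma star_one [simp]: "star (1::'a::cstar_algebra) = 1"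
  by (metis mult_1 mult_1_right star_mult star_star)

lemma star_scaleR: "star (r *\<^sub>R x::'a::cstar_algebra) = r *\<^sub>R star x"
  by (simp add: scaleR_scaleC star_scaleC)

lemma star_sum: "star (sum f S::'a::cstar_algebra) = (\<Sum>i\<in>S. star (f i))"
  by (induction S rule: infinite_finite_induct) (simp_all add: star_add)

lemma star_power: "star (x ^ k::'a::cstar_algebra) = star x ^ k"
  by (induction k) (simp_all add: star_mult power_commutes)

lemma norm_star [simp]: "norm (star x::'a::cstar_algebra) = norm x"
proof -
  have le: "norm y \<le> norm (star y)" for y :: 'a
  proof (cases "y = 0")
    case False
    have "(norm y)\<^sup>2 \<le> norm (star y) * norm y"
      using norm_mult_ineq[of "star y" y] by (simp add: cstar_identity)
    then show ?thesis using False by (simp add: power2_eq_square)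
  qed simp
  show ?thesis using le[of x] le[of "star x"] by (simp add: star_star)
qed

lemma bounded_linear_star: "bounded_linear (star :: 'a::cstar_algebra \<Rightarrow> 'a)"
  by (rule bounded_linear_intro[of _ 1]) (simp_all add: star_add star_scaleR)

lemma star_square_eq_0: "x = 0" if "star x * x = 0" for x :: "'a::cstar_algebra"
  using cstar_identity[of x] that by simp

lemma norm_selfadjoint_square: "norm (x * x) = (norm x)\<^sup>2" if "star x = x" for x :: "'a::cstar_algebra"
  using cstar_identity[of x] that by simp

text \<open>Fixed-point iteration for \<open>z = (x + z * z) / 2\<close>, which says
  \<open>(1 - z) * (1 - z) = 1 - x\<close>; the limit plays the role of
  \<open>1 - sqrt (1 - x)\<close>.\<close>

fun sqrt_iter :: "'a::real_algebra_1 \<Rightarrow> nat \<Rightarrow> 'a" where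
  "sqrt_iter x 0 = 0"
| "sqrt_iter x (Suc k) = (1/2) *\<^sub>R (x + sqrt_iter x k * sqrt_iter x k)"

lemma sqrt_iter_commute: "x * y = y * x \<Longrightarrow> sqrt_iter x k * y = y * sqrt_iter x k"
proof (induction k)
  case (Suc k)
  then show ?case by (simp add: algebra_simps) (metis mult.assoc)
qed simp

lemma sqrt_iter_commute_self: "sqrt_iter x j * sqrt_iter x k = sqrt_iter x k * sqrt_iter x j"
  by (intro sqrt_iter_commute sqrt_iter_commute[symmetric] refl)

lemma sqrt_iter_one: "0 \<le> sqrt_iter (1::real) k \<and> sqrt_iter (1::real) k \<le> 1"
proof (induction k)
  case (Suc k)
  then show ?case by (auto simp: mult_le_one)
qed simp

text \<open>The iterates are polynomials in \<open>x\<close> with nonnegative coefficients, so their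
  values at the scalar 1 majorise their norms.\<close>

lemma norm_sqrt_iter_le:
  fixes x :: "'a::real_normed_algebra_1"
  assumes "norm x \<le> 1"
  shows "norm (sqrt_iter x k) \<le> sqrt_iter (1::real) k"
proof (induction k)
  case (Suc k)
  have "norm (sqrt_iter x k * sqrt_iter x k) \<le> sqrt_iter 1 k * sqrt_iter 1 k"
    using Suc by (meson norm_mult_ineq mult_mono norm_ge_zero order_trans)
  moreover have "norm (x + sqrt_iter x k * sqrt_iter x k)
      \<le> norm x + norm (sqrt_iter x k * sqrt_iter x k)" by (rule norm_triangle_ineq)
  ultimately show ?case using assms by simp
qed simp

text \<open>The iterates commute, so the difference of squares factorises as for scalars, and each
  factor is majorised by its scalar counterpart.\<close>

lemma norm_sqrt_iter_diff_le:
  fixes x :: "'a::real_normed_algebra_1"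
  assumes "norm x \<le> 1"
  shows "norm (sqrt_iter x (Suc k) - sqrt_iter x k)
    \<le> sqrt_iter (1::real) (Suc k) - sqrt_iter 1 k"
proof (induction k)
  case 0
  then show ?case using assms by simp
next
  case (Suc k)
  let ?a = "sqrt_iter x (Suc k)" and ?b = "sqrt_iter x k"
  let ?r = "sqrt_iter (1::real) (Suc k)" and ?s = "sqrt_iter (1::real) k"
  have "sqrt_iter x (Suc (Suc k)) - ?a = (1/2) *\<^sub>R (?a * ?a - ?b * ?b)"
    by (simp only: sqrt_iter.simps(2)[of x "Suc k"] sqrt_iter.simps(2)[of x k]
        scaleR_right_diff_distrib[symmetric] add_diff_cancel_left)
  also have "?a * ?a - ?b * ?b = (?a - ?b) * (?a + ?b)"
    using sqrt_iter_commute_self[of x k "Suc k"] by (simp only: algebra_simps)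
  finally have "norm (sqrt_iter x (Suc (Suc k)) - ?a) = (1/2) * norm ((?a - ?b) * (?a + ?b))"
    by (simp only: norm_scaleR)
  also have "\<dots> \<le> (1/2) * ((?r - ?s) * (?r + ?s))"
  proof -
    have "norm (?a + ?b) \<le> ?r + ?s"
      using norm_sqrt_iter_le[OF assms, of k] norm_sqrt_iter_le[OF assms, of "Suc k"]
        norm_triangle_ineq[of ?a ?b] by linarith
    then have "norm ((?a - ?b) * (?a + ?b)) \<le> (?r - ?s) * (?r + ?s)"
      using Suc by (meson norm_mult_ineq mult_mono norm_ge_zero order_trans)
    then show ?thesis by simp
  qed
  also have "\<dots> = sqrt_iter (1::real) (Suc (Suc k)) - ?r"
    by (simp only: sqrt_iter.simps(2)[of "1::real" "Suc k"] sqrt_iter.simps(2)[of "1::real" k])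
       (simp add: algebra_simps)
  finally show ?case .
qed

text \<open>The increments are dominated by a convergent telescoping scalar series. The limit
  inherits self-adjointness and commutation with \<open>y\<close> from the iterates.\<close>

lemma exists_sqrt_one_minus:
  fixes x :: "'a::cstar_algebra"
  assumes "norm x \<le> 1" and sa: "star x = x"
  obtains z where "norm z \<le> 1" "star z = z" "(1 - z) * (1 - z) = 1 - x"
    "\<And>y. x * y = y * x \<Longrightarrow> z * y = y * z"
proof -
  let ?s = "sqrt_iter x" and ?r = "sqrt_iter (1::real)"
  have inc: "?r k \<le> ?r (Suc k)" for k
    using norm_sqrt_iter_diff_le[of "1::real" k] norm_ge_zero
    by (metis diff_ge_0_iff_ge norm_one order_refl order_trans)
  have "convergent ?r"
    by (rule Bseq_monoseq_convergent)
       (use sqrt_iter_one inc in \<open>auto intro!: BseqI'[of _ 1] mono_SucI1\<close>)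
  then obtain l where "?r \<longlonglongrightarrow> l" by (auto simp: convergent_def)
  then have "summable (\<lambda>k. ?r (Suc k) - ?r k)"
    by (rule telescope_summable)
  then have "summable (\<lambda>k. ?s (Suc k) - ?s k)"
    by (rule summable_comparison_test'[where N = 0]) (rule norm_sqrt_iter_diff_le[OF assms(1)])
  then have "(\<lambda>k. \<Sum>j<k. ?s (Suc j) - ?s j) \<longlonglongrightarrow> (\<Sum>j. ?s (Suc j) - ?s j)"
    by (rule summable_LIMSEQ)
  then obtain z where z: "?s \<longlonglongrightarrow> z"
    by (simp only: sum_lessThan_telescope) auto
  have "norm (?s k) \<le> 1" for k
    using norm_sqrt_iter_le[OF assms(1), of k] sqrt_iter_one[of k] by linarith
  then have n: "norm z \<le> 1"
    by (intro LIMSEQ_le_const2[OF tendsto_norm[OF z]]) auto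
  have "star (?s k) = ?s k" for k
    by (induction k) (simp_all add: star_scaleR star_add star_mult sa)
  then have "?s \<longlonglongrightarrow> star z"
    using bounded_linear.tendsto[OF bounded_linear_star z] by simp
  then have s: "star z = z"
    using z by (rule LIMSEQ_unique)
  have "(\<lambda>k. ?s (Suc k)) \<longlonglongrightarrow> z" using z by (rule LIMSEQ_Suc)
  moreover have "(\<lambda>k. ?s (Suc k)) \<longlonglongrightarrow> (1/2) *\<^sub>R (x + z * z)"
    by (simp only: sqrt_iter.simps) (intro tendsto_intros z)
  ultimately have "z = (1/2) *\<^sub>R (x + z * z)" by (rule LIMSEQ_unique)
  then have "2 *\<^sub>R z = 2 *\<^sub>R ((1/2) *\<^sub>R (x + z * z))" by (rule arg_cong)
  then have "2 *\<^sub>R z = x + z * z" by simp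
  then have q: "(1 - z) * (1 - z) = 1 - x" by (simp add: algebra_simps scaleR_2)
  have c: "z * y = y * z" if "x * y = y * x" for y
  proof -
    have "(\<lambda>k. ?s k * y) \<longlonglongrightarrow> z * y" "(\<lambda>k. y * ?s k) \<longlonglongrightarrow> y * z"
      by (intro tendsto_intros z)+
    then show ?thesis by (simp only: sqrt_iter_commute[OF that] LIMSEQ_unique)
  qed
  show ?thesis using that n s q c by blast
qed

section \<open>Self-adjoint elements as real parts of unitaries\<close>

lemma norm_unitary: "norm u = 1" if "star u * u = 1" for u :: "'a::cstar_algebra"
  using cstar_identity[of u] that by (simp add: power2_eq_1_iff) (smt (verit) norm_ge_zero)

lemma unitary_of_sum_squares:
  fixes a g :: "'a::cstar_algebra"
  assumes "star a = a" "star g = g" "a * g = g * a" "a * a + g * g = 1"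
  shows "star (a + \<i> *\<^sub>C g) * (a + \<i> *\<^sub>C g) = 1"
  using assms by (simp add: star_add star_scaleC ring_distribs mult_scaleC_left mult_scaleC_right
      scaleC_scaleC scaleC_minus_left scaleC_one scaleC_add_right scaleC_diff_right algebra_simps)

text \<open>\<open>a\<close> is the real part of the unitary
  \<open>u = a + \<i> *\<^sub>C g\<close>. The second bound comes from
  \<open>4 (1 - a\<^sup>2) = 2 - (u\<^sup>2 + (star u)\<^sup>2)\<close>.\<close>

lemma norm_le_one_of_sum_squares:
  fixes a g :: "'a::cstar_algebra"
  assumes "star a = a" "star g = g" "a * g = g * a" "a * a + g * g = 1"
  shows "norm a \<le> 1" and "norm (1 - a * a) \<le> 1"
proof -
  let ?u = "a + \<i> *\<^sub>C g"
  have u: "norm ?u = 1" by (rule norm_unitary[OF unitary_of_sum_squares[OF assms]])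
  have "?u + star ?u = 2 *\<^sub>R a"
    using assms by (simp add: star_add star_scaleC scaleC_minus_left scaleR_2)
  then have "2 * norm a \<le> 2"
    using norm_triangle_ineq[of ?u "star ?u"] u by simp
  then show "norm a \<le> 1" by simp
  have g: "g * g = 1 - a * a" using assms(4) by (simp add: algebra_simps)
  have "g * g = 1 - a * a" "?u * ?u + star ?u * star ?u = 2 *\<^sub>R (a * a) - 2 *\<^sub>R (g * g)"
    using assms g by (simp_all add: star_add star_scaleC scaleC_minus_left scaleR_2 ring_distribs
      mult_scaleC_left mult_scaleC_right scaleC_scaleC scaleC_one scaleC_add_right
      scaleC_diff_right scaleC_minus_right)
  moreover have "4 *\<^sub>R (1 - p) = 2 *\<^sub>R 1 - (2 *\<^sub>R p - 2 *\<^sub>R (1 - p))" for p :: 'a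
    using scaleR_add_left[of 2 2 p] scaleR_add_left[of 2 2 "1::'a"]
    by (simp add: scaleR_right_diff_distrib del: scaleR_left.add)
  ultimately have "4 *\<^sub>R (1 - a * a) = 2 *\<^sub>R 1 - (?u * ?u + star ?u * star ?u)"
    by (simp only:)
  then have "norm (4 *\<^sub>R (1 - a * a)) \<le> 2 + (norm (?u * ?u) + norm (star ?u * star ?u))"
    using norm_triangle_ineq4[of "2 *\<^sub>R (1::'a)" "?u * ?u + star ?u * star ?u"]
      norm_triangle_ineq[of "?u * ?u" "star ?u * star ?u"] by simp
  also have "\<dots> \<le> 2 + (1 + 1)"
    using norm_mult_ineq[of ?u ?u] norm_mult_ineq[of "star ?u" "star ?u"] u by simp
  finally show "norm (1 - a * a) \<le> 1" by simp
qed

text \<open>A square root of \<open>1 - e * e\<close> serves as the \<open>g\<close> of the previous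
  bound. The result makes the root construction applicable to \<open>1 - e * e\<close>, which
  produces a root of \<open>e * e\<close>.\<close>

lemma norm_one_minus_square_le:
  fixes e :: "'a::cstar_algebra"
  assumes "star e = e" "norm e \<le> 1"
  shows "norm (1 - e * e) \<le> 1"
proof -
  have "norm (e * e) \<le> 1"
    using assms by (simp add: norm_selfadjoint_square power_le_one)
  then obtain z where z: "star z = z" "(1 - z) * (1 - z) = 1 - e * e"
    "\<And>y. (e * e) * y = y * (e * e) \<Longrightarrow> z * y = y * z"
    using exists_sqrt_one_minus[of "e * e"] assms by (metis star_mult)
  have "e * z = z * e" using z(3)[of e] by (simp add: mult.assoc)
  then have "e * (1 - z) = (1 - z) * e" by (simp add: algebra_simps)
  moreover have "e * e + (1 - z) * (1 - z) = 1" using z(2) by (simp only:) simp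
  ultimately show ?thesis
    using norm_le_one_of_sum_squares(2)[of e "1 - z"] assms(1) z(1) by (simp add: star_diff)
qed

text \<open>With \<open>f\<^sup>2 = |e|\<close>, odd powers of the positive part of \<open>e\<close> are visibly positive.\<close>

lemma exists_fourth_root:
  fixes e :: "'a::cstar_algebra"
  assumes sa: "star e = e" and "norm e \<le> 1"
  obtains f where "star f = f" "(f * f) * (f * f) = e * e"
    "\<And>y. e * y = y * e \<Longrightarrow> f * y = y * f"
proof -
  have "star (1 - e * e) = 1 - e * e" by (simp add: star_diff star_mult sa)
  \<comment> \<open>\<open>1 - z\<close> is a square root of \<open>e * e\<close> and stands for
    \<open>|e|\<close>; as \<open>norm z \<le> 1\<close>, it has a square root \<open>1 - v\<close>
    in turn.\<close>
  then obtain z where z: "norm z \<le> 1" "star z = z" "(1 - z) * (1 - z) = 1 - (1 - e * e)"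
    "\<And>y. (1 - e * e) * y = y * (1 - e * e) \<Longrightarrow> z * y = y * z"
    using exists_sqrt_one_minus[OF norm_one_minus_square_le[OF assms]] by metis
  obtain v where v: "star v = v" "(1 - v) * (1 - v) = 1 - z"
    "\<And>y. z * y = y * z \<Longrightarrow> v * y = y * v"
    using exists_sqrt_one_minus[OF z(1,2)] by metis
  show ?thesis
  proof (rule that[of "1 - v"])
    fix y assume "e * y = y * e"
    then have "(1 - e * e) * y = y * (1 - e * e)" by (simp add: algebra_simps) (metis mult.assoc)
    then have "v * y = y * v" by (intro v(3) z(4))
    then show "(1 - v) * y = y * (1 - v)" by (simp add: algebra_simps)
  qed (use z v in \<open>simp_all add: star_diff\<close>)
qed

subsection \<open>Faithful states and norms\<close>

lemma mult_commute_mult: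
  fixes x y a :: "'a::semigroup_mult"
  assumes "x * a = a * x" "y * a = a * y"
  shows "x * y * a = a * (x * y)"
proof -
  have "x * y * a = x * a * y" using assms(2) by (simp add: mult.assoc)
  then show ?thesis using assms(1) by (simp add: mult.assoc)
qed

locale faithful_state_space =
  fixes \<phi> :: "'a::cstar_algebra \<Rightarrow> complex"
  assumes faithful: "faithful_state \<phi>"
begin

lemma state_add: "\<phi> (x + y) = \<phi> x + \<phi> y"
  and state_scaleC: "\<phi> (a *\<^sub>C x) = a * \<phi> x"
  and state_one: "\<phi> 1 = 1"
  using faithful by (simp_all add: faithful_state_def)

lemma state_zero: "\<phi> 0 = 0"
  using state_add[of 0 0] by simp

lemma state_minus: "\<phi> (- x) = - \<phi> x"
  using state_add[of "-x" x] by (simp add: state_zero eq_neg_iff_add_eq_0)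

lemma state_diff: "\<phi> (x - y) = \<phi> x - \<phi> y"
  using state_add[of x "-y"] by (simp add: state_minus)

lemma state_scaleR: "\<phi> (r *\<^sub>R x) = r * \<phi> x"
  by (simp add: scaleR_scaleC state_scaleC)

lemma state_sum: "\<phi> (sum f S) = (\<Sum>i\<in>S. \<phi> (f i))"
  by (induction S rule: infinite_finite_induct) (simp_all add: state_add state_zero)

text \<open>Squared norm of the GNS space on which left multiplication acts. \<open>norm2\<close>
  takes the factors in the opposite order, hence the \<open>star\<close> in
  \<open>norm2_eq\<close>.\<close>

definition sqn :: "'a \<Rightarrow> real" where
  "sqn x = Re (\<phi> (star x * x))"

lemma state_square: "\<phi> (star x * x) = complex_of_real (sqn x)"
  and sqn_nonneg: "0 \<le> sqn x"
proof -
  have "\<phi> (star x * x) \<in> \<real>\<^sub>\<ge>\<^sub>0" using faithful by (simp add: faithful_state_def)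
  then show "\<phi> (star x * x) = complex_of_real (sqn x)" "0 \<le> sqn x"
    by (auto simp: sqn_def complex_nonneg_Reals_iff complex_eq_iff)
qed

lemma sqn_eq_0: "sqn x = 0 \<longleftrightarrow> x = 0"
proof
  assume "sqn x = 0"
  then have "\<phi> (star x * x) = 0" by (simp add: state_square)
  then show "x = 0" using faithful by (simp add: faithful_state_def)
qed (simp add: sqn_def state_zero)

text \<open>The state is real on \<open>star y * y\<close>; taking \<open>y = x + 1\<close> gives
  the imaginary part of the claim and \<open>y = \<i> *\<^sub>C x + 1\<close> the real part.\<close>

lemma state_star: "\<phi> (star x) = cnj (\<phi> x)"
proof -
  have im: "Im (\<phi> (star y * y)) = 0" for y by (simp add: state_square)
  have "star (x + 1) * (x + 1) = star x * x + star x + x + 1"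
    by (simp add: star_add algebra_simps)
  then have 1: "Im (\<phi> (star x)) + Im (\<phi> x) = 0"
    using im[of "x + 1"] by (simp add: state_add state_one im)
  have "star (\<i> *\<^sub>C x + 1) * (\<i> *\<^sub>C x + 1) = star x * x - \<i> *\<^sub>C star x + \<i> *\<^sub>C x + 1"
    by (simp add: star_add star_scaleC algebra_simps mult_scaleC_left mult_scaleC_right
        scaleC_scaleC scaleC_minus_left scaleC_one scaleC_minus_right
        scaleC_diff_right scaleC_add_right)
  then have 2: "Re (\<phi> x) - Re (\<phi> (star x)) = 0"
    using im[of "\<i> *\<^sub>C x + 1"] by (simp add: state_add state_one im state_diff state_scaleC)
  show ?thesis using 1 2 by (simp add: complex_eq_iff)
qed

lemma cauchy_schwarz: "(cmod (\<phi> (star y * x)))\<^sup>2 \<le> sqn y * sqn x"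
proof (cases "y = 0")
  case False
  then have pos: "sqn y > 0" using sqn_nonneg[of y] sqn_eq_0[of y] by linarith
  define s where "s = \<phi> (star y * x)"
  \<comment> \<open>Coefficient of the orthogonal projection of \<open>x\<close> onto
    \<open>y\<close>.\<close>
  define t where "t = s / sqn y"
  have s': "\<phi> (star x * y) = cnj s"
    using state_star[of "star y * x"] by (simp add: star_mult star_star s_def)
  have "star (x - t *\<^sub>C y) * (x - t *\<^sub>C y)
      = star x * x - t *\<^sub>C (star x * y) - cnj t *\<^sub>C (star y * x) + (cnj t * t) *\<^sub>C (star y * y)"
    by (simp add: star_diff star_scaleC algebra_simps mult_scaleC_left mult_scaleC_right
        scaleC_scaleC scaleC_diff_right)
  then have "\<phi> (star (x - t *\<^sub>C y) * (x - t *\<^sub>C y))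
      = sqn x - t * cnj s - cnj t * s + cnj t * t * sqn y"
    by (simp add: state_add state_diff state_scaleC s' state_square flip: s_def)
  also have "\<dots> = sqn x - (s * cnj s) / sqn y"
    using pos by (simp add: t_def field_simps)
  also have "\<dots> = complex_of_real (sqn x - (cmod s)\<^sup>2 / sqn y)"
    by (simp add: complex_norm_square[symmetric])
  finally have "sqn (x - t *\<^sub>C y) = sqn x - (cmod s)\<^sup>2 / sqn y"
    by (simp only: state_square of_real_eq_iff)
  then have "(cmod s)\<^sup>2 / sqn y \<le> sqn x" using sqn_nonneg[of "x - t *\<^sub>C y"] by simp
  then show ?thesis using pos by (simp add: divide_le_eq mult.commute flip: s_def)
qed (simp add: state_zero sqn_def)

lemma sqn_scaleC: "sqn (a *\<^sub>C x) = (cmod a)\<^sup>2 * sqn x"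
proof -
  have "\<phi> (star (a *\<^sub>C x) * (a *\<^sub>C x)) = (a * cnj a) * \<phi> (star x * x)"
    by (simp add: star_scaleC mult_scaleC_left mult_scaleC_right scaleC_scaleC state_scaleC mult_ac)
  then show ?thesis by (simp add: state_square complex_norm_square[symmetric] flip: of_real_mult of_real_power)
qed

text \<open>After scaling \<open>x\<close> to norm 1, \<open>1 - star x * x\<close> is the square of
  a self-adjoint element, so the state is nonnegative on it.\<close>

lemma sqn_le_norm: "sqn x \<le> (norm x)\<^sup>2"
proof (cases "x = 0")
  case False
  let ?h = "(1 / (norm x)\<^sup>2) *\<^sub>R (star x * x)"
  have "norm ?h \<le> 1" "star ?h = ?h"
    using False by (simp_all add: cstar_identity star_scaleR star_mult star_star)
  then obtain z where z: "star z = z" "(1 - z) * (1 - z) = 1 - ?h"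
    using exists_sqrt_one_minus by metis
  then have "\<phi> (star (1 - z) * (1 - z)) = 1 - complex_of_real (sqn x / (norm x)\<^sup>2)"
    by (simp add: star_diff state_diff state_one state_scaleR state_square)
  then have "sqn (1 - z) = 1 - sqn x / (norm x)\<^sup>2"
    by (simp add: sqn_def)
  then have "sqn x / (norm x)\<^sup>2 \<le> 1" using sqn_nonneg[of "1 - z"] by linarith
  then show ?thesis using False by (simp add: divide_le_eq_1)
qed (simp add: sqn_def state_zero)

lemma norm2_eq: "norm2 \<phi> x = sqrt (sqn (star x))"
  by (simp add: norm2_def sqn_def star_star)

text \<open>If \<open>p\<close> is the positive part of \<open>a\<^sup>2 - 1\<close>, then \<open>\<phi> (a\<^sup>2\<^sup>m p\<^sup>2)\<close> grows at least like
  \<open>m \<phi> (p\<^sup>3)\<close>, while the hypothesis bounds it through Cauchy--Schwarz. So \<open>p = 0\<close>, and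
  \<open>1 - a\<^sup>2\<close> has a square root \<open>g\<close>, which makes \<open>a\<close> the real part of the unitary \<open>a + i g\<close>.\<close>

lemma norm_le_one_of_moments:
  assumes sa: "star a = a" and mom: "\<And>m. sqn (a ^ m) \<le> 1"
  shows "norm a \<le> 1"
proof -
  \<comment> \<open>The summand 1 keeps \<open>s\<close> positive even if \<open>a * a = 1\<close>,
    and \<open>e\<close> still has norm at most 1.\<close>
  define s where "s = norm (a * a - 1) + 1"
  have s: "s > 0" by (simp add: s_def add_nonneg_pos)
  define e where "e = (1 / s) *\<^sub>R (a * a - 1)"
  have e: "star e = e" and ea: "e * a = a * e"
    by (simp_all add: e_def star_scaleR star_diff star_mult sa algebra_simps)
  have ne: "norm e \<le> 1"
    using s by (simp add: e_def divide_le_eq_1) (simp add: s_def)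
  have aa: "a * a = 1 + s *\<^sub>R e" using s by (simp add: e_def)
  obtain f where f: "star f = f" "(f * f) * (f * f) = e * e"
    "\<And>y. e * y = y * e \<Longrightarrow> f * y = y * f"
    using exists_fourth_root[OF e ne] by metis
  have fe: "f * e = e * f" and fa: "f * a = a * f" by (simp_all add: f(3) ea)
  \<comment> \<open>\<open>f * f\<close> stands for \<open>|e|\<close>, so \<open>p\<close> is the
    positive part of \<open>e\<close>.\<close>
  define p where "p = (1/2) *\<^sub>R (f * f + e)"
  have p: "star p = p" by (simp add: p_def star_scaleR star_add star_mult f(1) e)
  have pa: "p * a = a * p" and fp: "f * p = p * f"
  proof -
    have "f * f * a = a * (f * f)" by (intro mult_commute_mult fa)
    then show "p * a = a * p" by (simp add: p_def ring_distribs ea)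
    show "f * p = p * f" by (simp add: p_def ring_distribs fe mult.assoc)
  qed
  have ep: "e * p = p * p"
  proof -
    have "4 *\<^sub>R (p * p) = (f * f + e) * (f * f + e)" by (simp add: p_def)
    also have "\<dots> = f * f * (f * f) + e * (f * f) + e * e + f * f * e"
      by (simp add: ring_distribs)
    also have "f * f * e = e * (f * f)" by (intro mult_commute_mult fe)
    also have "f * f * (f * f) + e * (f * f) + e * e + e * (f * f) = 2 *\<^sub>R (e * (f * f + e))"
      using f(2) by (simp add: ring_distribs scaleR_2)
    also have "\<dots> = 4 *\<^sub>R (e * p)" by (simp add: p_def)
    finally show ?thesis by simp
  qed
  have ffp: "f * (f * p) = p * p"
  proof -
    have "f * f = 2 *\<^sub>R p - e" by (simp add: p_def)
    then have "(f * f) * p = 2 *\<^sub>R (p * p) - e * p" by (simp add: left_diff_distrib)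
    then show ?thesis by (simp add: ep mult.assoc scaleR_2)
  qed
  \<comment> \<open>\<open>v m x\<close> is the real part of
    \<open>\<phi> (a\<^sup>2\<^sup>m x)\<close>; \<open>p\<close> and \<open>f\<close> can be moved
    freely past the powers of \<open>a\<close>.\<close>
  define v where "v m x = Re (\<phi> (star (a ^ m) * (a ^ m * x)))" for m x
  have ap: "p * (a ^ m * x) = a ^ m * (p * x)" for m x
    using power_commuting_commutes[of a p m] pa by (simp flip: mult.assoc)
  have af: "f * (a ^ m * x) = a ^ m * (f * x)" for m x
    using power_commuting_commutes[of a f m] fa by (simp flip: mult.assoc)
  have sap: "star (a ^ m) = a ^ m" for m by (simp add: star_power sa)
  have vp: "v m (p * (p * p)) = sqn (a ^ m * (f * p))" for m
  proof -
    have "star (a ^ m * (f * p)) * (a ^ m * (f * p)) = a ^ m * (a ^ m * (p * (f * (f * p))))"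
      by (simp add: star_mult sap f(1) p mult.assoc ap af)
    then show ?thesis by (simp add: v_def sqn_def sap ffp)
  qed
  have vp2: "v m (p * (p * (p * p))) = sqn (a ^ m * (p * p))" for m
  proof -
    have "star (a ^ m * (p * p)) * (a ^ m * (p * p)) = a ^ m * (a ^ m * (p * (p * (p * p))))"
      by (simp add: star_mult sap p mult.assoc ap)
    then show ?thesis by (simp add: v_def sqn_def sap)
  qed
  \<comment> \<open>Since \<open>a * a = 1 + s *\<^sub>R e\<close> and \<open>e * p = p * p\<close>,
    raising \<open>m\<close> by one adds \<open>s\<close> times the moment with one more factor
    \<open>p\<close>.\<close>
  have step: "v (Suc m) (p * x) = v m (p * x) + s * v m (p * (p * x))" for m x
  proof -
    have "a ^ Suc m * (a ^ Suc m * (p * x)) = a ^ m * (a ^ m * ((a * a) * (p * x)))"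
    proof -
      have "a * (a ^ m * z) = a ^ m * (a * z)" for z
        by (simp add: power_commutes flip: mult.assoc)
      then show ?thesis by (simp add: mult.assoc)
    qed
    also have "(a * a) * (p * x) = p * x + s *\<^sub>R ((e * p) * x)"
      by (simp add: aa algebra_simps)
    finally show ?thesis
      by (simp add: v_def sap ep algebra_simps state_add state_scaleR del: power_Suc)
  qed
  have v3: "v m (p * (p * p)) \<ge> sqn (f * p)" for m
  proof (induction m)
    case 0
    then show ?case using vp[of 0] by simp
  next
    case (Suc m)
    have "s * v m (p * (p * (p * p))) \<ge> 0" using s by (simp add: vp2 sqn_nonneg)
    then show ?case using Suc step[of m "p * p"] by linarith
  qed
  have v2: "v m (p * p) \<ge> m * (s * sqn (f * p))" for m
  proof (induction m)
    case 0
    then show ?case using sqn_nonneg[of p] by (simp add: v_def sqn_def p)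
  next
    case (Suc m)
    have "s * v m (p * (p * p)) \<ge> s * sqn (f * p)" using s v3 by simp
    then show ?case using Suc step[of m p] by (simp add: algebra_simps)
  qed
  \<comment> \<open>All powers of \<open>a\<close> go to one side of Cauchy-Schwarz, so the
    hypothesis is used at exponent \<open>2 * m\<close>.\<close>
  have ub: "v m (p * p) \<le> sqrt (sqn (p * p))" for m
  proof -
    have "star (a ^ (2 * m)) * (p * p) = star (a ^ m) * (a ^ m * (p * p))"
      by (simp only: sap) (simp only: mult_2 power_add mult.assoc)
    then have "v m (p * p) \<le> cmod (\<phi> (star (a ^ (2 * m)) * (p * p)))"
      by (metis v_def complex_Re_le_cmod)
    also have "\<dots> \<le> sqrt (sqn (a ^ (2 * m)) * sqn (p * p))"
      using cauchy_schwarz by (rule real_le_rsqrt)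
    also have "\<dots> \<le> sqrt (1 * sqn (p * p))"
      by (intro real_sqrt_le_mono mult_right_mono mom sqn_nonneg)
    finally show ?thesis by simp
  qed
  have "sqn (f * p) = 0"
  proof (rule ccontr)
    assume "sqn (f * p) \<noteq> 0"
    then have "s * sqn (f * p) > 0" using s sqn_nonneg[of "f * p"] by simp
    then obtain m :: nat where "sqrt (sqn (p * p)) < m * (s * sqn (f * p))"
      using reals_Archimedean3 by blast
    then show False using ub[of m] v2[of m] by linarith
  qed
  \<comment> \<open>Faithfulness gives \<open>f * p = 0\<close>, and
    \<open>p * p = f * (f * p)\<close>.\<close>
  then have "p * p = 0" using ffp by (simp add: sqn_eq_0)
  then have "p = 0" using star_square_eq_0[of p] p by simp
  then have "e = - (f * f)" by (simp add: p_def eq_neg_iff_add_eq_0 add.commute)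
  then have "a * a + (sqrt s *\<^sub>R f) * (sqrt s *\<^sub>R f) = 1"
    using s aa by simp
  then show ?thesis
    using norm_le_one_of_sum_squares(1)[of a "sqrt s *\<^sub>R f"] f(1) fa sa by (simp add: star_scaleR)
qed

lemma norm_le_of_moments:
  assumes sa: "star h = h" and K: "0 \<le> K" and mom: "\<And>m. sqn (h ^ m) \<le> (K ^ m)\<^sup>2"
  shows "norm h \<le> K"
proof (cases "K = 0")
  case True
  then show ?thesis using mom[of 1] sqn_nonneg[of h] by (simp add: sqn_eq_0)
next
  case False
  have "sqn (((1 / K) *\<^sub>R h) ^ m) \<le> 1" for m
  proof -
    have "sqn (((1 / K) *\<^sub>R h) ^ m) = ((1 / K) ^ m)\<^sup>2 * sqn (h ^ m)"
    proof -
      have "((1 / K) *\<^sub>R h) ^ m = complex_of_real ((1 / K) ^ m) *\<^sub>C h ^ m"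
        by (simp only: scaleR_power scaleR_scaleC[symmetric])
      then show ?thesis by (simp only: sqn_scaleC norm_of_real power2_abs)
    qed
    also have "\<dots> \<le> ((1 / K) ^ m)\<^sup>2 * (K ^ m)\<^sup>2" by (intro mult_left_mono mom) simp
    also have "\<dots> = 1" using False by (simp add: power_divide)
    finally show ?thesis .
  qed
  then have "norm ((1 / K) *\<^sub>R h) \<le> 1"
    by (intro norm_le_one_of_moments) (simp_all add: star_scaleR sa)
  then show ?thesis using False K by (simp add: field_simps)
qed

end

subsection \<open>Wick products and freeness\<close>

text \<open>Free Wick products: prepending a letter subtracts its contraction with the next one. In
  the applications \<open>g l l'\<close> is the covariance
  \<open>\<phi> (x l * x l')\<close>.\<close>

fun wick :: "('l \<Rightarrow> 'a::cstar_algebra) \<Rightarrow> ('l \<Rightarrow> 'l \<Rightarrow> complex) \<Rightarrow> 'l list \<Rightarrow> 'a" where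
  "wick x g [] = 1"
| "wick x g [l] = x l"
| "wick x g (l # l' # w) = x l * wick x g (l' # w) - g l l' *\<^sub>C wick x g w"

lemma wick_map: "wick x g (map f w) = wick (\<lambda>l. x (f l)) (\<lambda>l l'. g (f l) (f l')) w"
  by (induction "\<lambda>l. x (f l)" "\<lambda>l l'. g (f l) (f l')" w rule: wick.induct) simp_all

text \<open>Only neighbouring letters are contracted, so a vanishing covariance at the junction
  decouples the two words.\<close>

lemma wick_append:
  assumes "u \<noteq> []" "v \<noteq> []" "g (last u) (hd v) = 0"
  shows "wick x g (u @ v) = wick x g u * wick x g v"
  using assms
proof (induction x g u rule: wick.induct)
  case (2 x g l)
  then show ?case by (cases v) simp_all
next
  case (3 x g l l' w)
  have "wick x g (w @ v) = wick x g w * wick x g v"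
    using 3 by (cases "w = []") simp_all
  then show ?case using 3 by (simp add: algebra_simps mult_scaleC_left)
qed simp

lemma wick_in_star_subalgebra:
  assumes "\<And>l. l \<in> set w \<Longrightarrow> x l \<in> star_subalgebra S"
  shows "wick x g w \<in> star_subalgebra S"
  using assms
proof (induction x g w rule: wick.induct)
  case (3 x g l l' w)
  have "x l * wick x g (l' # w) + (- g l l') *\<^sub>C wick x g w \<in> star_subalgebra S"
    using 3 by (intro star_subalgebra.add star_subalgebra.mult star_subalgebra.scale) auto
  then show ?case by (simp add: scaleC_minus_left)
qed (auto intro: star_subalgebra.intros)

text \<open>Maximal runs of equal index: a new first letter either joins the first block or opens
  one of its own. Adjacent blocks then differ in index, as freeness demands.\<close>

lemma exists_blocks:
  assumes "w \<noteq> []"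
  shows "\<exists>bs. bs \<noteq> [] \<and> concat bs = w \<and> distinct_adj (map (\<lambda>b. idx (hd b)) bs) \<and>
    (\<forall>b\<in>set bs. b \<noteq> [] \<and> (\<forall>l\<in>set b. idx (hd b) = idx l))"
  using assms
proof (induction w rule: list_nonempty_induct)
  case (single l)
  then show ?case by (intro exI[of _ "[[l]]"]) simp
next
  case (cons l w)
  from cons.IH obtain bs' where bs': "bs' \<noteq> []" "concat bs' = w"
    "distinct_adj (map (\<lambda>b. idx (hd b)) bs')"
    "\<forall>b\<in>set bs'. b \<noteq> [] \<and> (\<forall>l\<in>set b. idx (hd b) = idx l)"
    by (elim exE conjE) (rule that)
  from bs'(1) obtain b bs where "bs' = b # bs" by (cases bs') auto
  note b = bs'[unfolded this]
  show ?case
  proof (cases "idx l = idx (hd b)")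
    case True
    have "distinct_adj (map (\<lambda>b. idx (hd b)) ((l # b) # bs))"
      using b(3) True by (cases bs) simp_all
    moreover have "\<forall>b'\<in>set ((l # b) # bs). b' \<noteq> [] \<and> (\<forall>k\<in>set b'. idx (hd b') = idx k)"
      using b(4) True by simp
    ultimately show ?thesis using b(2) by (intro exI[of _ "(l # b) # bs"]) simp
  next
    case False
    have "distinct_adj (map (\<lambda>b. idx (hd b)) ([l] # b # bs))"
      using b(3) False by simp
    moreover have "\<forall>b'\<in>set ([l] # b # bs). b' \<noteq> [] \<and> (\<forall>k\<in>set b'. idx (hd b') = idx k)"
      using b(4) by simp
    ultimately show ?thesis using b(2) by (intro exI[of _ "[l] # b # bs"]) simp
  qed
qed

lemma wick_concat:
  assumes "distinct_adj (map (\<lambda>b. idx (hd b)) bs)"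
    and "\<forall>b\<in>set bs. b \<noteq> [] \<and> (\<forall>l\<in>set b. idx (hd b) = idx l)"
    and "\<And>l l'. idx l \<noteq> idx l' \<Longrightarrow> g l l' = 0"
  shows "wick x g (concat bs) = prod_list (map (wick x g) bs)"
  using assms(1,2)
proof (induction bs)
  case (Cons b bs)
  note prems = Cons.prems and IH = Cons.IH
  show ?case
  proof (cases bs)
    case bs: (Cons b' bs')
    have "idx (last b) \<noteq> idx (hd b')"
    proof -
      have "idx (hd b) = idx (last b)" using prems(2) last_in_set[of b] by auto
      then show ?thesis using prems(1) by (simp add: bs)
    qed
    then have "g (last b) (hd b') = 0" by (rule assms(3))
    moreover have "hd (concat bs) = hd b'" "concat bs \<noteq> []" "b \<noteq> []"
      using prems(2) by (simp_all add: bs)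
    ultimately have "wick x g (b @ concat bs) = wick x g b * wick x g (concat bs)"
      by (intro wick_append) simp_all
    moreover have "wick x g (concat bs) = prod_list (map (wick x g) bs)"
      using prems by (intro IH) (simp_all add: bs)
    ultimately show ?thesis by simp
  qed simp
qed simp

context faithful_state_space begin

text \<open>A Wick product over free subalgebras splits into the Wick products of its maximal
  one-index blocks, an alternating product of centred elements.\<close>

lemma state_wick_free:
  assumes free: "free_subalgebras \<phi> I (\<lambda>i. star_subalgebra (S i))"
    and x: "\<And>l. l \<in> L \<Longrightarrow> idx l \<in> I \<and> x l \<in> star_subalgebra (S (idx l))"
    and g: "\<And>l l'. idx l \<noteq> idx l' \<Longrightarrow> g l l' = 0"
    and blocks: "\<And>w i. w \<noteq> [] \<Longrightarrow> set w \<subseteq> L \<Longrightarrow> (\<forall>l\<in>set w. i = idx l) \<Longrightarrow> \<phi> (wick x g w) = 0"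
    and w: "w \<noteq> []" "set w \<subseteq> L"
  shows "\<phi> (wick x g w) = 0"
proof -
  obtain bs where bs: "bs \<noteq> []" "concat bs = w" "distinct_adj (map (\<lambda>b. idx (hd b)) bs)"
    "\<forall>b\<in>set bs. b \<noteq> [] \<and> (\<forall>l\<in>set b. idx (hd b) = idx l)"
    using exists_blocks[OF w(1)] by metis
  let ?ks = "map (\<lambda>b. idx (hd b)) bs" and ?xs = "map (wick x g) bs"
  have sub: "set b \<subseteq> L" if "b \<in> set bs" for b
  proof -
    have "set b \<subseteq> set (concat bs)" using that by auto
    then show ?thesis using w(2) bs(2) by simp
  qed
  have "?xs ! j \<in> star_subalgebra (S (?ks ! j)) \<and> \<phi> (?xs ! j) = 0" if "j < length bs" for j
  proof -
    let ?b = "bs ! j"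
    have b: "?b \<in> set bs" "?b \<noteq> []" "\<forall>l\<in>set ?b. idx (hd ?b) = idx l"
      using that bs(4) by auto
    have "wick x g ?b \<in> star_subalgebra (S (idx (hd ?b)))"
    proof (rule wick_in_star_subalgebra)
      fix l assume l: "l \<in> set ?b"
      then have "l \<in> L" using sub[OF b(1)] by blast
      then have "x l \<in> star_subalgebra (S (idx l))" using x by blast
      moreover have "idx (hd ?b) = idx l" using b(3) l by blast
      ultimately show "x l \<in> star_subalgebra (S (idx (hd ?b)))" by simp
    qed
    then show ?thesis using that blocks[OF b(2) sub[OF b(1)] b(3)] by simp
  qed
  moreover have "set ?ks \<subseteq> I"
  proof -
    have "idx (hd b) \<in> I" if "b \<in> set bs" for b
      using x sub[OF that] bs(4) that hd_in_set by blast
    then show ?thesis by auto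
  qed
  ultimately have "\<phi> (prod_list ?xs) = 0"
    using free[unfolded free_subalgebras_def, rule_format, of ?ks ?xs] bs(1,3) by simp
  then show ?thesis using wick_concat[OF bs(3,4), of g x] g bs(2) by simp
qed

end

text \<open>Multilinear expansion along the substitution \<open>l \<mapsto> \<Sum>m. A l m \<cdot> m\<close> of letters.\<close>

fun expand :: "('l \<Rightarrow> bool \<Rightarrow> complex) \<Rightarrow> 'l list \<Rightarrow> (bool list \<Rightarrow> 'a::cstar_algebra) \<Rightarrow> 'a" where
  "expand A [] f = f []"
| "expand A (l # w) f = (\<Sum>m\<in>UNIV. A l m *\<^sub>C expand A w (\<lambda>v. f (m # v)))"

lemma expand_diff: "expand A w (\<lambda>v. f v - h v) = expand A w f - expand A w h"
  by (induction w arbitrary: f h) (simp_all add: scaleC_diff_right sum_subtractf)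

lemma expand_scaleC: "expand A w (\<lambda>v. a *\<^sub>C f v) = a *\<^sub>C expand A w f"
  by (induction w arbitrary: f) (simp_all add: scaleC_sum_right scaleC_scaleC mult.commute)

lemma expand_mult: "expand A w (\<lambda>v. y * f v) = y * expand A w f"
  by (induction w arbitrary: f) (simp_all add: sum_distrib_left mult_scaleC_right)

text \<open>The recursion is bilinear in the two leading letters, so Wick products are compatible
  with linear substitutions once the covariance is transformed along.\<close>

lemma wick_expand:
  assumes x': "\<And>l. x' l = (\<Sum>m\<in>UNIV. A l m *\<^sub>C x m)"
    and g': "\<And>l l'. g' l l' = (\<Sum>m\<in>UNIV. \<Sum>m'\<in>UNIV. A l m * A l' m' * g m m')"
  shows "wick x' g' w = expand A w (wick x g)"
proof (induction w rule: induct_list012)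
  case (3 l l' w)
  have "expand A (l # l' # w) (wick x g) = (\<Sum>m\<in>UNIV. A l m *\<^sub>C (\<Sum>m'\<in>UNIV. A l' m' *\<^sub>C
      (x m * expand A w (\<lambda>v. wick x g (m' # v)) - g m m' *\<^sub>C expand A w (wick x g))))"
    by (simp add: expand_diff expand_scaleC expand_mult)
  also have "\<dots> = x' l * expand A (l' # w) (wick x g) - g' l l' *\<^sub>C expand A w (wick x g)"
    by (simp add: x' g' UNIV_bool scaleC_add_right scaleC_add_left scaleC_diff_right scaleC_scaleC
        mult_scaleC_left mult_scaleC_right algebra_simps)
  finally show ?case using 3 by simp
qed (simp_all add: x')

context faithful_state_space begin

lemma state_expand:
  assumes "\<And>v. length v = length w \<Longrightarrow> \<phi> (f v) = 0"
  shows "\<phi> (expand A w f) = 0"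
  using assms
  by (induction w arbitrary: f) (simp_all add: state_sum state_scaleC)

text \<open>A Wick product is a fixed noncommutative polynomial in its letters, so its state depends
  on the star-moments alone.\<close>

lemma state_wick_eq:
  assumes "star_distribution \<phi> x = star_distribution \<phi> y"
  shows "\<phi> (wick (\<lambda>b. if b then star x else x) g w) = \<phi> (wick (\<lambda>b. if b then star y else y) g w)"
proof -
  define P where "P z u = prod_list (map (\<lambda>b. if b then star z else z) u)" for z :: 'a and u
  have P: "\<phi> (P x u) = \<phi> (P y u)" for u
    using fun_cong[OF assms, of u] by (simp add: star_distribution_def P_def)
  define X where "X = (\<lambda>z::'a. \<lambda>b. if b then star z else z)"
  have snoc: "P z (u @ [l]) = P z u * X z l" for z u l by (simp add: P_def X_def)
  \<comment> \<open>The prefix \<open>u\<close> collects the letters already peeled off by the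
    recursion.\<close>
  have "\<phi> (P x u * wick (X x) g w) = \<phi> (P y u * wick (X y) g w)" for u
  proof (induction w arbitrary: u rule: induct_list012)
    case 1
    then show ?case using P by simp
  next
    case (2 l)
    then show ?case using P[of "u @ [l]"] by (simp add: snoc)
  next
    case (3 l l' w)
    have "\<phi> (P z u * wick (X z) g (l # l' # w))
        = \<phi> (P z (u @ [l]) * wick (X z) g (l' # w)) - g l l' * \<phi> (P z u * wick (X z) g w)" for z
      by (simp add: snoc right_diff_distrib mult.assoc mult_scaleC_right state_diff state_scaleC)
    then show ?case using 3 by simp
  qed
  from this[of "[]"] show ?thesis by (simp add: P_def X_def)
qed

end

subsection \<open>Semicircular and circular elements\<close>

text \<open>Chebyshev polynomials of the second kind in the variable \<open>t / 2\<close>: the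
  orthonormal polynomials of the semicircle law.\<close>

fun chebyshev_U :: "nat \<Rightarrow> real \<Rightarrow> real" where
  "chebyshev_U 0 t = 1"
| "chebyshev_U (Suc 0) t = t"
| "chebyshev_U (Suc (Suc k)) t = t * chebyshev_U (Suc k) t - chebyshev_U k t"

lemma chebyshev_U_cos: "chebyshev_U k (2 * cos \<theta>) * sin \<theta> = sin (real (Suc k) * \<theta>)"
proof (induction k "2 * cos \<theta>" rule: chebyshev_U.induct)
  case 2
  then show ?case by (simp add: sin_double)
next
  case (3 k)
  let ?a = "real (Suc (Suc k)) * \<theta>"
  have "real (Suc (Suc (Suc k))) * \<theta> = ?a + \<theta>" "real (Suc k) * \<theta> = ?a - \<theta>"
    by (simp_all add: algebra_simps)
  then show ?case using 3 by (simp add: left_diff_distrib mult.assoc sin_add sin_diff del: of_nat_Suc)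
qed simp

lemma continuous_on_chebyshev_U: "continuous_on S (chebyshev_U k)"
proof (induction k rule: induct_nat_012)
  case (ge2 k)
  have "chebyshev_U (Suc (Suc k)) = (\<lambda>t. t * chebyshev_U (Suc k) t - chebyshev_U k t)" by auto
  then show ?case using ge2 by (auto intro!: continuous_intros)
qed (auto simp: fun_eq_iff cong: continuous_on_cong)

text \<open>With \<open>t = 2 * cos \<theta>\<close> the integrand becomes a difference of two
  cosines of multiples of \<open>\<theta>\<close>. Its antiderivative \<open>F\<close> is a
  combination of sines, which vanish at \<open>\<theta> = 0\<close> and
  \<open>\<theta> = pi\<close>.\<close>

lemma chebyshev_U_integral:
  "((\<lambda>t. chebyshev_U (Suc k) t * sqrt (4 - t\<^sup>2)) has_integral 0) {-2..2}"
proof -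
  define F where "F t = 2 * (sin (real (k + 3) * arccos (t / 2)) / real (k + 3)
    - sin (real (k + 1) * arccos (t / 2)) / real (k + 1))" for t
  have "((\<lambda>t. chebyshev_U (Suc k) t * sqrt (4 - t\<^sup>2)) has_integral (F 2 - F (-2))) {-2..2}"
  \<comment> \<open>The interior version is used because \<open>arccos (t / 2)\<close> is not
    differentiable at the end points.\<close>
  proof (rule fundamental_theorem_of_calculus_interior)
    show "continuous_on {-2..2} F"
      unfolding F_def by (intro continuous_intros) auto
    fix t :: real assume t: "t \<in> {-2<..<2}"
    define \<theta> where "\<theta> = arccos (t / 2)"
    have \<theta>: "t = 2 * cos \<theta>" "0 < \<theta>" "\<theta> < pi"
      using t arccos_lt_bounded[of "t / 2"] by (simp_all add: \<theta>_def cos_arccos)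
    have sin: "sin \<theta> > 0" using \<theta> by (intro sin_gt_zero)
    have "sqrt (1 - (t / 2)\<^sup>2) = sin \<theta>"
      using sin by (simp add: \<theta>(1) sin_squared_eq[symmetric])
    then have "(arccos has_field_derivative - 1 / sin \<theta>) (at (t / 2))"
      using DERIV_arccos[of "t / 2"] t sin by (simp add: field_simps)
    then have d: "((\<lambda>t. arccos (t / 2)) has_field_derivative (- 1 / sin \<theta>) * (1 / 2)) (at t)"
      by (rule DERIV_chain2) (auto intro!: derivative_eq_intros)
    have "(F has_field_derivative 2 * (cos (real (k + 3) * \<theta>) - cos (real (k + 1) * \<theta>))
        * ((- 1 / sin \<theta>) * (1 / 2))) (at t)"
    proof -
      define D where "D = (- 1 / sin \<theta>) * (1 / 2)"
      have "((\<lambda>t. sin (real m * arccos (t / 2)) / real m) has_field_derivative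
          cos (real m * \<theta>) * D) (at t)" if "m > 0" for m
      proof -
        have "((\<lambda>t. sin (real m * arccos (t / 2)) / real m) has_field_derivative
            cos (real m * \<theta>) * (real m * D) / real m) (at t)"
          unfolding \<theta>_def
          by (intro DERIV_cdivide DERIV_chain2[OF DERIV_sin] DERIV_cmult d[folded D_def])
        also have "cos (real m * \<theta>) * (real m * D) / real m = cos (real m * \<theta>) * D"
          using that by simp
        finally show ?thesis .
      qed
      from DERIV_cmult[OF DERIV_diff[OF this[of "k + 3"] this[of "k + 1"]], of 2]
      show ?thesis unfolding F_def D_def[symmetric]
        by (simp add: left_diff_distrib mult.assoc)
    qed
    also have "2 * (cos (real (k + 3) * \<theta>) - cos (real (k + 1) * \<theta>)) * ((- 1 / sin \<theta>) * (1 / 2))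
        = chebyshev_U (Suc k) t * sqrt (4 - t\<^sup>2)"
    proof -
      let ?a = "real (Suc (Suc k)) * \<theta>"
      have "real (k + 3) * \<theta> = ?a + \<theta>" "real (k + 1) * \<theta> = ?a - \<theta>"
        by (simp_all add: algebra_simps)
      then have "cos (real (k + 3) * \<theta>) - cos (real (k + 1) * \<theta>) = - 2 * sin ?a * sin \<theta>"
        by (simp only: cos_add cos_diff)
      also have "sin ?a = chebyshev_U (Suc k) t * sin \<theta>"
        by (simp only: \<theta>(1) chebyshev_U_cos)
      finally have "cos (real (k + 3) * \<theta>) - cos (real (k + 1) * \<theta>)
        = - 2 * (chebyshev_U (Suc k) t * sin \<theta>) * sin \<theta>" .
      moreover have "sqrt (4 - t\<^sup>2) = 2 * sin \<theta>"
      proof -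
        have "4 - t\<^sup>2 = (2 * sin \<theta>)\<^sup>2"
          by (simp add: \<theta>(1) power_mult_distrib sin_squared_eq)
        then have "sqrt (4 - t\<^sup>2) = \<bar>2 * sin \<theta>\<bar>" by (simp only: real_sqrt_abs)
        then show ?thesis using sin by simp
      qed
      ultimately show ?thesis using sin by simp
    qed
    finally show "(F has_vector_derivative chebyshev_U (Suc k) t * sqrt (4 - t\<^sup>2)) (at t)"
      by (simp add: has_real_derivative_iff_has_vector_derivative)
  qed simp
  moreover have "F 2 = 0" by (simp add: F_def)
  moreover have "F (-2) = 0"
  proof -
    have "(-2::real) / 2 = -1" by simp
    then show ?thesis by (simp only: F_def arccos_minus_1 sin_npi) simp
  qed
  ultimately show ?thesis by simp
qed

context faithful_state_space begin

text \<open>For a single letter of variance 1 the Wick recursion is the Chebyshev recursion, so the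
  state is the integral computed above.\<close>

lemma state_semicircular_wick:
  assumes s: "semicircular \<phi> s" and g: "g l l = 1" and x: "x l = s"
  shows "\<phi> (wick x g (replicate (Suc k) l)) = 0"
proof -
  define W where "W k j t = t ^ j * chebyshev_U k t * (1 / (2 * pi) * sqrt (4 - t\<^sup>2))"
    for k j and t :: real
  have int: "W k j integrable_on {-2..2}" for k j
    unfolding W_def
    by (intro integrable_continuous_interval continuous_intros continuous_on_chebyshev_U)
  \<comment> \<open>The factor \<open>s ^ j\<close> is carried along because the recursion absorbs
    one more \<open>s\<close> into it.\<close>
  have mom: "\<phi> (s ^ j * wick x g (replicate k l)) = complex_of_real (integral {-2..2} (W k j))" for k j
  proof (induction k arbitrary: j rule: induct_nat_012)
    case 0
    then show ?case using s by (simp add: semicircular_def W_def[abs_def])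
  next
    case 1
    have "\<phi> (s ^ j * s) = \<phi> (s ^ Suc j)" by (simp add: power_commutes)
    moreover have "\<phi> (s ^ Suc j) = complex_of_real
        (integral {-2..2} (\<lambda>t. t ^ Suc j * (1 / (2 * pi) * sqrt (4 - t\<^sup>2))))"
      using s unfolding semicircular_def by blast
    moreover have "(\<lambda>t. t ^ Suc j * (1 / (2 * pi) * sqrt (4 - t\<^sup>2))) = W (Suc 0) j"
      by (auto simp: W_def)
    ultimately show ?case by (simp only: x wick.simps replicate.simps)
  next
    case (ge2 k)
    have "W (Suc (Suc k)) j = (\<lambda>t. W (Suc k) (Suc j) t - W k j t)"
      by (simp add: W_def fun_eq_iff algebra_simps diff_divide_distrib)
    then have "integral {-2..2} (W (Suc (Suc k)) j)
        = integral {-2..2} (W (Suc k) (Suc j)) - integral {-2..2} (W k j)"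
      by (simp add: integral_diff int)
    moreover have "s ^ j * wick x g (replicate (Suc (Suc k)) l)
        = s ^ Suc j * wick x g (replicate (Suc k) l) - s ^ j * wick x g (replicate k l)"
      by (simp add: g x algebra_simps scaleC_one power_commutes)
        (simp add: power_commutes flip: mult.assoc)
    ultimately show ?case by (simp only: ge2 state_diff of_real_diff)
  qed
  have "(W (Suc k) 0 has_integral 0) {-2..2}"
    using has_integral_mult_right[OF chebyshev_U_integral[of k], of "1 / (2 * pi)"]
    by (simp add: W_def[abs_def] mult_ac)
  then show ?thesis using mom[of 0 "Suc k"] by (simp add: integral_unique)
qed

text \<open>The circular element is replaced by its model \<open>z\<close>, and the Wick product is
  expanded in the free semicircular elements, whose Wick products are centred.\<close>

lemma state_circular_wick:
  assumes "circular \<phi> c" and w: "w \<noteq> []"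
  shows "\<phi> (wick (\<lambda>b. if b then star c else c) (\<lambda>b b'. of_bool (b \<noteq> b')) w) = 0"
proof -
  obtain s1 s2 where s: "semicircular \<phi> s1" "semicircular \<phi> s2"
    and free: "star_free \<phi> UNIV (case_bool s1 s2)"
    and dist: "star_distribution \<phi> c =
          star_distribution \<phi> (complex_of_real (1 / sqrt 2) *\<^sub>C (s1 + \<i> *\<^sub>C s2))"
    using assms(1) by (auto simp: circular_def)
  define z where "z = complex_of_real (1 / sqrt 2) *\<^sub>C (s1 + \<i> *\<^sub>C s2)"
  let ?x = "case_bool s1 s2" and ?g = "\<lambda>m m'::bool. of_bool (m = m') :: complex"
  \<comment> \<open>Coordinates of \<open>z\<close> and \<open>star z\<close>, where
    \<open>True\<close> selects \<open>s1\<close> and \<open>False\<close> selects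
    \<open>s2\<close>. They turn the identity covariance into 0 for equal and 1 for opposite
    letters.\<close>
  define A :: "bool \<Rightarrow> bool \<Rightarrow> complex" where
    "A b m = complex_of_real (1 / sqrt 2) * (if m then 1 else if b then - \<i> else \<i>)" for b m
  have sqrt2: "complex_of_real (sqrt 2) * complex_of_real (sqrt 2) = 2"
    by (simp flip: of_real_mult)
  have semi: "\<phi> (wick ?x ?g v) = 0" if "v \<noteq> []" for v
  proof (rule state_wick_free[where idx = "\<lambda>m. m" and L = UNIV])
    show "free_subalgebras \<phi> UNIV (\<lambda>i. star_subalgebra {?x i})"
      using free by (simp add: star_free_def)
    fix v :: "bool list" and i assume v: "v \<noteq> []" "\<forall>l\<in>set v. i = l"
    then have "replicate (length v) i = v" by (intro replicate_eqI[symmetric]) auto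
    then have "v = replicate (Suc (length v - 1)) i" using v(1) by simp
    moreover have "semicircular \<phi> (?x i)" using s by (cases i) simp_all
    ultimately show "\<phi> (wick ?x ?g v) = 0"
      by (metis (full_types) state_semicircular_wick of_bool_eq(2))
  qed (use that in \<open>auto intro: star_subalgebra.gen\<close>)
  have "star s1 = s1" "star s2 = s2" using s by (simp_all add: semicircular_def)
  then have "wick (\<lambda>b. if b then star z else z) (\<lambda>b b'. of_bool (b \<noteq> b')) w
      = expand A w (wick ?x ?g)"
    by (intro wick_expand)
      (auto simp: A_def UNIV_bool z_def star_scaleC star_add scaleC_add_right scaleC_scaleC
        mult_ac sqrt2)
  then have "\<phi> (wick (\<lambda>b. if b then star z else z) (\<lambda>b b'. of_bool (b \<noteq> b')) w) = 0"
    using w by (simp only:) (auto intro!: state_expand semi)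
  then show ?thesis using state_wick_eq dist z_def by metis
qed

end

subsection \<open>The Fock basis of a family of free circular elements\<close>

definition enc :: "bool \<Rightarrow> 'i list \<Rightarrow> ('i \<times> bool) list" where
  "enc b r = map (\<lambda>i. (i, b)) r"

locale circular_family = faithful_state_space \<phi> for \<phi> :: "'a::cstar_algebra \<Rightarrow> complex" +
  fixes c :: "'i \<Rightarrow> 'a" and I :: "'i set"
  assumes circ: "\<And>i. i \<in> I \<Longrightarrow> circular \<phi> (c i)" and free: "star_free \<phi> I c"
begin

text \<open>The letter \<open>(i, False)\<close> stands for \<open>c i\<close> and \<open>(i, True)\<close> for its adjoint. The elements
  \<open>basis w\<close> are orthonormal; they realise the word basis of a full Fock space on which
  \<open>c i\<close> acts as the creation operator of \<open>(i, False)\<close> plus the annihilation operator of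
  \<open>(i, True)\<close>.\<close>

definition letter :: "'i \<times> bool \<Rightarrow> 'a" where
  "letter l = (if snd l then star (c (fst l)) else c (fst l))"

definition flip :: "'i \<times> bool \<Rightarrow> 'i \<times> bool" where
  "flip l = (fst l, \<not> snd l)"

definition basis :: "('i \<times> bool) list \<Rightarrow> 'a" where
  "basis = wick letter (\<lambda>l l'. of_bool (l' = flip l))"

abbreviation letters :: "('i \<times> bool) set" where
  "letters \<equiv> I \<times> UNIV"

lemma flip_flip [simp]: "flip (flip l) = l"
  by (simp add: flip_def)

lemma star_letter: "star (letter l) = letter (flip l)"
  by (simp add: letter_def flip_def star_star)

lemma basis_Nil [simp]: "basis [] = 1"
  by (simp add: basis_def)

text \<open>The Wick recursion solved for the product: creation plus annihilation.\<close>

lemma letter_basis: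
  "letter l * basis w = basis (l # w) + (if w \<noteq> [] \<and> hd w = flip l then basis (tl w) else 0)"
  by (cases w) (simp_all add: basis_def scaleC_one)

text \<open>Freeness reduces the claim to words with a single index, that is, to one circular
  element.\<close>

lemma state_basis:
  assumes "w \<noteq> []" "set w \<subseteq> letters"
  shows "\<phi> (basis w) = 0"
  unfolding basis_def
proof (rule state_wick_free[where idx = fst and L = letters and S = "\<lambda>i. {c i}" and I = I])
  show "free_subalgebras \<phi> I (\<lambda>i. star_subalgebra {c i})"
    using free by (simp add: star_free_def)
  show "fst l \<in> I \<and> letter l \<in> star_subalgebra {c (fst l)}" if "l \<in> letters" for l
    using that by (auto simp: letter_def intro: star_subalgebra.intros)
  show "of_bool (l' = flip l) = (0::complex)" if "fst l \<noteq> fst l'" for l l'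
    using that by (auto simp: flip_def)
  fix w i assume w: "w \<noteq> []" "set w \<subseteq> letters" "\<forall>l\<in>set w. i = fst l"
  then have "w = map (Pair i) (map snd w)"
    by (auto intro!: nth_equalityI simp: prod_eq_iff)
  moreover have "i \<in> I" using w by (cases w) auto
  then have 0: "\<phi> (wick (\<lambda>b. if b then star (c i) else c i) (\<lambda>b b'. of_bool (b \<noteq> b')) (map snd w)) = 0"
    using w by (intro state_circular_wick circ) simp_all
  have "\<phi> (wick letter (\<lambda>l l'. of_bool (l' = flip l)) (map (Pair i) (map snd w))) = 0"
  proof -
    have "letter (i, b) = (if b then star (c i) else c i)"
      "of_bool ((i, b') = flip (i, b)) = (of_bool (b \<noteq> b') :: complex)" for b b'
      by (auto simp: letter_def flip_def)
    with 0 show ?thesis by (simp only: wick_map)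
  qed
  ultimately show "\<phi> (wick letter (\<lambda>l l'. of_bool (l' = flip l)) w) = 0" by simp
qed (use assms in auto)

text \<open>The first letter of \<open>v\<close> moves to the other factor as its adjoint. The
  induction is on length because the contraction \<open>q\<close> shortens \<open>v\<close> by two
  letters.\<close>

lemma basis_orthonormal:
  assumes "set v \<subseteq> letters" "set w \<subseteq> letters"
  shows "\<phi> (star (basis v) * basis w) = of_bool (v = w)"
  using assms
proof (induction v arbitrary: w rule: length_induct)
  case (1 v)
  show ?case
  proof (cases v)
    case Nil
    then show ?thesis using state_basis 1 by (cases "w = []") (simp_all add: state_one)
  next
    case (Cons l v')
    have IH: "\<phi> (star (basis u) * basis y) = of_bool (u = y)"
      if "length u \<le> length v'" "set u \<subseteq> set v'" "set y \<subseteq> letters" for u y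
      using 1 that Cons by auto
    have fl: "flip l \<in> letters" using 1 Cons by (auto simp: flip_def)
    define q where "q = (if v' \<noteq> [] \<and> hd v' = flip l then basis (tl v') else 0)"
    have "basis v = letter l * basis v' - q"
      by (simp add: letter_basis Cons q_def)
    then have "star (basis v) * basis w = star (basis v') * (letter (flip l) * basis w) - star q * basis w"
      by (simp add: star_diff star_mult star_letter left_diff_distrib mult.assoc)
    also have "letter (flip l) * basis w
        = basis (flip l # w) + (if w \<noteq> [] \<and> hd w = l then basis (tl w) else 0)"
      by (simp add: letter_basis)
    finally have "\<phi> (star (basis v) * basis w) = \<phi> (star (basis v') * basis (flip l # w))
        + (if w \<noteq> [] \<and> hd w = l then \<phi> (star (basis v') * basis (tl w)) else 0)
        - (if v' \<noteq> [] \<and> hd v' = flip l then \<phi> (star (basis (tl v')) * basis w) else 0)"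
      by (simp add: distrib_left state_add state_diff state_zero q_def)
    \<comment> \<open>The term that creates \<open>flip l\<close> on \<open>w\<close> cancels
      against the contraction in \<open>basis v\<close>; only the annihilation of \<open>l\<close>
      remains.\<close>
    also have "\<dots> = of_bool (v' = flip l # w) + of_bool (w = l # v')
        - of_bool (v' = flip l # w)"
    proof -
      have "\<phi> (star (basis v') * basis (flip l # w)) = of_bool (v' = flip l # w)"
        using 1 fl by (intro IH) auto
      moreover have "(if w \<noteq> [] \<and> hd w = l then \<phi> (star (basis v') * basis (tl w)) else 0)
          = of_bool (w = l # v')"
        using 1 by (cases w) (auto simp: IH)
      moreover have "(if v' \<noteq> [] \<and> hd v' = flip l then \<phi> (star (basis (tl v')) * basis w) else 0)
          = of_bool (v' = flip l # w)"
      proof (cases v')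
        case (Cons k u)
        then have "\<phi> (star (basis u) * basis w) = of_bool (u = w)"
          using 1 by (intro IH) auto
        then show ?thesis by (simp add: Cons)
      qed simp
      ultimately show ?thesis by (simp only:)
    qed
    finally show ?thesis by (simp add: Cons eq_commute[of w])
  qed
qed

lemma sqn_sum_basis:
  assumes "finite F" "\<And>w. w \<in> F \<Longrightarrow> set w \<subseteq> letters"
  shows "sqn (\<Sum>w\<in>F. \<beta> w *\<^sub>C basis w) = (\<Sum>w\<in>F. (cmod (\<beta> w))\<^sup>2)"
proof -
  let ?b = "\<Sum>w\<in>F. \<beta> w *\<^sub>C basis w"
  have "\<phi> (star ?b * ?b)
      = (\<Sum>v\<in>F. \<Sum>w\<in>F. cnj (\<beta> v) * \<beta> w * \<phi> (star (basis v) * basis w))"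
    by (simp add: star_sum star_scaleC sum_product state_sum state_scaleC mult_scaleC_left
        mult_scaleC_right scaleC_scaleC mult_ac)
  also have "\<dots> = (\<Sum>v\<in>F. \<Sum>w\<in>F. if v = w then cnj (\<beta> v) * \<beta> v else 0)"
    by (intro sum.cong refl) (simp add: basis_orthonormal assms)
  also have "\<dots> = complex_of_real (\<Sum>w\<in>F. (cmod (\<beta> w))\<^sup>2)"
    using assms(1) by (simp add: sum.delta mult.commute complex_norm_square[symmetric])
  finally show ?thesis by (simp add: sqn_def)
qed

text \<open>Opposite letters are of different kinds, so no contraction occurs in a word of one
  kind.\<close>

lemma prod_letters:
  assumes "\<And>l. l \<in> set w \<Longrightarrow> snd l = b"
  shows "prod_list (map letter w) = basis w"
  using assms
proof (induction w)
  case (Cons l w)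
  have "hd w \<noteq> flip l" if "w \<noteq> []"
  proof -
    have "snd (hd w) = snd l" using Cons.prems that by simp
    then show ?thesis by (auto simp: flip_def)
  qed
  then show ?case using Cons by (auto simp: letter_basis)
qed simp

lemma prod_letters_enc: "prod_list (map letter (enc b r)) = basis (enc b r)"
  by (rule prod_letters[of _ b]) (auto simp: enc_def)

lemma word_prod_eq_basis: "word_prod c r = basis (enc False r)"
  unfolding prod_letters_enc[symmetric]
  by (simp add: enc_def word_prod_def letter_def comp_def)

lemma star_word_prod_eq_basis: "star (word_prod c r) = basis (enc True (rev r))"
  unfolding prod_letters_enc[symmetric]
  by (induction r) (simp_all add: word_prod_def enc_def star_mult letter_def)

text \<open>Each factor either creates an unstarred letter or annihilates a starred one, so nothing can be
  annihilated after a creation: of the \<open>2\<^sup>n\<close> terms only those survive in which a terminal segment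
  annihilates and the remaining letters create.\<close>

lemma word_prod_basis:
  "word_prod c r * basis z = (\<Sum>k\<le>length r.
     if take (length r - k) z = enc True (rev (drop k r)) then basis (enc False (take k r) @ drop (length r - k) z) else 0)"
proof (induction r arbitrary: z rule: rev_induct)
  case Nil
  then show ?case by (simp add: word_prod_def enc_def)
next
  case (snoc i r)
  let ?f = "\<lambda>r z k. if take (length r - k) z = enc True (rev (drop k r))
    then basis (enc False (take k r) @ drop (length r - k) z) else 0"
  \<comment> \<open>The last factor has created a letter. An unstarred leading letter blocks every
    annihilation, so only \<open>k = length r\<close> survives.\<close>
  have "word_prod c r * basis ((i, False) # z) = ?f (r @ [i]) z (Suc (length r))"
  proof -
    have "?f r ((i, False) # z) k = 0" if "k < length r" for k
    proof -
      have "take (length r - k) ((i, False) # z) \<noteq> enc True (rev (drop k r))"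
      proof
        assume eq: "take (length r - k) ((i, False) # z) = enc True (rev (drop k r))"
        have "(i, False) \<in> set (take (length r - k) ((i, False) # z))"
          using that by (simp add: take_Cons')
        then show False unfolding eq by (auto simp: enc_def)
      qed
      then show ?thesis by simp
    qed
    then have "(\<Sum>k\<le>length r. ?f r ((i, False) # z) k) = ?f r ((i, False) # z) (length r)"
      by (simp flip: lessThan_Suc_atMost)
    also have "\<dots> = ?f (r @ [i]) z (Suc (length r))" by (simp add: enc_def)
    finally show ?thesis by (simp only: snoc.IH)
  qed
  \<comment> \<open>The last factor has annihilated a letter; this accounts for all
    \<open>k \<le> length r\<close>.\<close>
  moreover have "word_prod c r * (if z \<noteq> [] \<and> hd z = (i, True) then basis (tl z) else 0)
    = (\<Sum>k\<le>length r. ?f (r @ [i]) z k)"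
  proof (cases "z \<noteq> [] \<and> hd z = (i, True)")
    case True
    then obtain z' where z: "z = (i, True) # z'" by (cases z) auto
    have "?f (r @ [i]) z k = ?f r z' k" if "k \<le> length r" for k
      using that by (simp add: z Suc_diff_le enc_def)
    then show ?thesis using snoc.IH[of z'] z by simp
  next
    case False
    have "?f (r @ [i]) z k = 0" if "k \<le> length r" for k
      using that False by (cases z) (auto simp: Suc_diff_le enc_def)
    then show ?thesis using False by (simp only: if_False mult_zero_right) simp
  qed
  moreover have "word_prod c (r @ [i]) * basis z = word_prod c r * (letter (i, False) * basis z)"
    by (simp add: word_prod_def letter_def mult.assoc)
  then have "word_prod c (r @ [i]) * basis z = word_prod c r * basis ((i, False) # z)
      + word_prod c r * (if z \<noteq> [] \<and> hd z = (i, True) then basis (tl z) else 0)"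
    unfolding letter_basis by (simp add: flip_def distrib_left)
  ultimately show ?case by simp
qed

end

subsection \<open>Weights on words\<close>

definition starts :: "nat \<Rightarrow> bool \<Rightarrow> ('i \<times> bool) list \<Rightarrow> bool" where
  "starts k b w \<longleftrightarrow> k \<le> length w \<and> (\<forall>l\<in>set (take k w). snd l = b)"

lemma starts_0 [simp]: "starts 0 b w"
  by (simp add: starts_def)

lemma starts_Suc_Nil [simp]: "\<not> starts (Suc k) b []"
  by (simp add: starts_def)

lemma starts_Suc_Cons [simp]: "starts (Suc k) b (l # w) \<longleftrightarrow> snd l = b \<and> starts k b w"
  by (auto simp: starts_def)

lemma enc_starts: "starts k b w \<Longrightarrow> enc b (map fst (take k w)) = take k w"
  by (auto simp: starts_def enc_def comp_def prod_eq_iff intro!: map_idI)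

lemma length_enc [simp]: "length (enc b u) = length u"
  by (simp add: enc_def)

lemma map_fst_enc [simp]: "map fst (enc b u) = u"
  by (simp add: enc_def comp_def)

lemma starts_enc: "starts (length u) b (enc b u @ y)"
  by (auto simp: starts_def enc_def)

definition letter_words :: "nat \<Rightarrow> 'i set \<Rightarrow> ('i \<times> bool) list set" where
  "letter_words M J = {w. set w \<subseteq> J \<times> UNIV \<and> length w \<le> M}"

lemma finite_letter_words: "finite J \<Longrightarrow> finite (letter_words M J)"
  unfolding letter_words_def by (intro finite_lists_length_le) simp

lemma finite_index_words: "finite J \<Longrightarrow> finite (index_words n J)"
  using finite_lists_length_eq[of J n] by (simp add: index_words_def conj_commute)

text \<open>The tail is reversed because \<open>c_r\<close> annihilates starred letters in the
  reverse order of its own indices.\<close>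

lemma sum_index_words_split:
  assumes "k \<le> n"
  shows "(\<Sum>r\<in>index_words n J. f r)
    = (\<Sum>u\<in>index_words k J. \<Sum>v\<in>index_words (n - k) J. f (u @ rev v))"
proof -
  have "(\<Sum>r\<in>index_words n J. f r)
    = (\<Sum>(u, v)\<in>index_words k J \<times> index_words (n - k) J. f (u @ rev v))"
    by (rule sum.reindex_bij_witness[where i = "\<lambda>(u, v). u @ rev v" and
          j = "\<lambda>r. (take k r, rev (drop k r))"])
      (use assms in \<open>auto simp: index_words_def dest!: in_set_takeD in_set_dropD\<close>)
  then show ?thesis by (simp add: sum.cartesian_product)
qed

text \<open>Gluing \<open>(u, y)\<close> to \<open>enc b u @ y\<close> is the bijection. The
  truncations by \<open>N\<close> and \<open>M\<close> do not match; the vanishing of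
  \<open>G\<close> bridges the gap.\<close>

lemma sum_starts:
  assumes J: "finite J"
    and M: "\<And>u y. M < length y \<Longrightarrow> G u y = 0" and N: "\<And>u y. N < k + length y \<Longrightarrow> G u y = 0"
  shows "(\<Sum>w\<in>letter_words N J. if starts k b w then G (map fst (take k w)) (drop k w) else 0)
    = (\<Sum>u\<in>index_words k J. \<Sum>y\<in>letter_words M J. G u y)"
proof -
  let ?W = "{w\<in>letter_words N J. starts k b w}"
  let ?X = "{w\<in>?W. M < length (drop k w)}"
  let ?Y = "{(u, y)\<in>index_words k J \<times> letter_words M J. N < k + length y}"
  have "(\<Sum>w\<in>?W. G (map fst (take k w)) (drop k w))
    = (\<Sum>(u, y)\<in>index_words k J \<times> letter_words M J. G u y)"
  proof (rule sum.reindex_bij_witness_not_neutral[where S' = ?X and T' = ?Y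
        and i = "\<lambda>(u, y). enc b u @ y" and j = "\<lambda>w. (map fst (take k w), drop k w)"])
    show "finite ?X" using finite_letter_words[OF J] by simp
    show "finite ?Y"
      by (rule finite_subset[of _ "index_words k J \<times> letter_words M J"])
        (auto intro: finite_letter_words finite_index_words J)
    fix w assume w: "w \<in> ?W - ?X"
    then have st: "starts k b w" "\<not> M < length (drop k w)" by auto
    show "(case (map fst (take k w), drop k w) of (u, y) \<Rightarrow> enc b u @ y) = w"
      using st by (simp add: enc_starts)
    show "(map fst (take k w), drop k w) \<in> index_words k J \<times> letter_words M J - ?Y"
      using st w by (fastforce simp: starts_def letter_words_def index_words_def
          dest!: in_set_takeD in_set_dropD)
  next
    fix p assume p: "p \<in> index_words k J \<times> letter_words M J - ?Y"
    obtain u y where uy: "p = (u, y)" by (cases p)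
    have len: "length u = k" using p uy by (simp add: index_words_def)
    show "(map fst (take k (case p of (u, y) \<Rightarrow> enc b u @ y)),
        drop k (case p of (u, y) \<Rightarrow> enc b u @ y)) = p"
      using len by (simp add: uy)
    show "(case p of (u, y) \<Rightarrow> enc b u @ y) \<in> ?W - ?X"
      using p len starts_enc[of u b y]
      by (auto simp: uy letter_words_def index_words_def enc_def)
  qed (use M N in auto)
  then show ?thesis
    using finite_letter_words[OF J] by (simp add: sum.cartesian_product sum.inter_filter)
qed

definition weight :: "real \<Rightarrow> nat \<Rightarrow> ('i \<times> bool) list \<Rightarrow> real" where
  "weight \<rho> k y = \<rho> ^ k * (if y \<noteq> [] \<and> \<not> snd (hd y) then 1 - \<rho> else 1)"

lemma weight_pos: "0 < \<rho> \<Longrightarrow> \<rho> < 1 \<Longrightarrow> 0 < weight \<rho> k y"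
  by (simp add: weight_def)

text \<open>If \<open>w\<close> begins with an unstarred letter, \<open>k = 0\<close> takes
  \<open>1 - \<rho>\<close> and the other terms are \<open>\<rho>\<close> times the sum for the
  tail. Otherwise only \<open>k = 0\<close> contributes.\<close>

lemma sum_weight_le:
  assumes "0 < \<rho>" "\<rho> < 1"
  shows "(\<Sum>k\<le>n. if starts k False w then weight \<rho> k (drop k w) else 0) \<le> 1"
proof (induction n arbitrary: w)
  case 0
  then show ?case using assms by (simp add: weight_def)
next
  case (Suc n)
  let ?S = "\<lambda>n w. \<Sum>k\<le>n. if starts k False w then weight \<rho> k (drop k w) else 0"
  have split: "?S (Suc n) w = weight \<rho> 0 w
    + (\<Sum>k\<le>n. if starts (Suc k) False w then weight \<rho> (Suc k) (drop (Suc k) w) else 0)"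
    by (simp only: sum.atMost_Suc_shift) simp
  show ?case
  proof (cases "w \<noteq> [] \<and> \<not> snd (hd w)")
    case True
    then obtain l w' where w: "w = l # w'" "\<not> snd l" by (cases w) auto
    have "?S (Suc n) w = (1 - \<rho>) + \<rho> * ?S n w'"
      unfolding split sum_distrib_left
      by (auto simp: w weight_def mult_ac intro!: sum.cong)
    also have "\<dots> \<le> (1 - \<rho>) + \<rho> * 1"
      using assms Suc by (intro add_left_mono mult_left_mono) auto
    finally show ?thesis by simp
  next
    case False
    then have "\<not> starts (Suc k) False w" for k by (cases w) auto
    then show ?thesis unfolding split using False assms by (simp add: weight_def)
  qed
qed

text \<open>A leading starred letter reduces \<open>n\<close> by one at the cost of
  \<open>1 / \<rho> ^ Suc n\<close>, which is exactly the increment of the bound.\<close>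

lemma sum_inverse_weight_le:
  assumes "0 < \<rho>" "\<rho> < 1"
  shows "(\<Sum>k\<le>n. if starts (n - k) True z then 1 / weight \<rho> k (drop (n - k) z) else 0)
    \<le> 1 / (\<rho> ^ n * (1 - \<rho>))"
proof (induction n arbitrary: z)
  case 0
  then show ?case using assms by (simp add: weight_def)
next
  case (Suc n)
  let ?S = "\<lambda>n z. \<Sum>k\<le>n. if starts (n - k) True z then 1 / weight \<rho> k (drop (n - k) z) else 0"
  have split: "?S (Suc n) z = (\<Sum>k\<le>n. if starts (Suc (n - k)) True z
      then 1 / weight \<rho> k (drop (Suc (n - k)) z) else 0) + 1 / weight \<rho> (Suc n) z"
    by (simp add: Suc_diff_le cong: if_cong)
  show ?case
  proof (cases "z \<noteq> [] \<and> snd (hd z)")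
    case True
    then obtain l z' where z: "z = l # z'" "snd l" by (cases z) auto
    have "?S (Suc n) z = ?S n z' + 1 / \<rho> ^ Suc n"
      unfolding split by (simp add: z weight_def cong: if_cong)
    also have "\<dots> \<le> 1 / (\<rho> ^ n * (1 - \<rho>)) + 1 / \<rho> ^ Suc n"
      using Suc by simp
    also have "\<dots> = 1 / (\<rho> ^ Suc n * (1 - \<rho>))"
      using assms by (simp add: field_simps)
    finally show ?thesis .
  next
    case False
    then have "\<not> starts (Suc k) True z" for k by (cases z) auto
    \<comment> \<open>Without a leading starred letter nothing can be annihilated, so only the term
      in which all factors create is left.\<close>
    then have "?S (Suc n) z = 1 / weight \<rho> (Suc n) z" unfolding split by simp
    also have "\<dots> \<le> 1 / (\<rho> ^ Suc n * (1 - \<rho>))"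
      using assms by (intro divide_left_mono) (auto simp: weight_def)
    finally show ?thesis .
  qed
qed

lemma cmod_sum_weighted:
  fixes t :: "'b \<Rightarrow> complex" and \<tau> :: "'b \<Rightarrow> real"
  assumes "finite S" "\<And>k. k \<in> S \<Longrightarrow> 0 < \<tau> k" "(\<Sum>k\<in>S. \<tau> k) \<le> 1"
  shows "(cmod (\<Sum>k\<in>S. t k))\<^sup>2 \<le> (\<Sum>k\<in>S. (cmod (t k))\<^sup>2 / \<tau> k)"
proof -
  have "(cmod (\<Sum>k\<in>S. t k))\<^sup>2 \<le> (\<Sum>k\<in>S. cmod (t k))\<^sup>2"
    by (intro power_mono norm_sum norm_ge_zero)
  also have "(\<Sum>k\<in>S. cmod (t k)) = (\<Sum>k\<in>S. sqrt (\<tau> k) * (cmod (t k) / sqrt (\<tau> k)))"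
    using assms(2) by (intro sum.cong refl) (metis nonzero_mult_div_cancel_left
        times_divide_eq_right real_sqrt_gt_0_iff less_irrefl)
  also have "\<dots>\<^sup>2 \<le> (\<Sum>k\<in>S. (sqrt (\<tau> k))\<^sup>2) * (\<Sum>k\<in>S. (cmod (t k) / sqrt (\<tau> k))\<^sup>2)"
    by (rule Cauchy_Schwarz_ineq_sum)
  also have "\<dots> = (\<Sum>k\<in>S. \<tau> k) * (\<Sum>k\<in>S. (cmod (t k))\<^sup>2 / \<tau> k)"
    using assms(2) by (intro arg_cong2[where f = "(*)"] sum.cong refl)
      (auto simp: power_divide less_imp_le)
  also have "\<dots> \<le> 1 * (\<Sum>k\<in>S. (cmod (t k))\<^sup>2 / \<tau> k)"
    using assms by (intro mult_right_mono sum_nonneg) (auto simp: less_imp_le)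
  finally show ?thesis by simp
qed

lemma cmod_sum_mult:
  fixes f g :: "'b \<Rightarrow> complex"
  shows "(cmod (\<Sum>v\<in>S. f v * g v))\<^sup>2 \<le> (\<Sum>v\<in>S. (cmod (f v))\<^sup>2) * (\<Sum>v\<in>S. (cmod (g v))\<^sup>2)"
proof -
  have "(cmod (\<Sum>v\<in>S. f v * g v))\<^sup>2 \<le> (\<Sum>v\<in>S. cmod (f v) * cmod (g v))\<^sup>2"
    by (intro power_mono norm_ge_zero) (simp add: norm_sum flip: norm_mult)
  also have "\<dots> \<le> (\<Sum>v\<in>S. (cmod (f v))\<^sup>2) * (\<Sum>v\<in>S. (cmod (g v))\<^sup>2)"
    by (rule Cauchy_Schwarz_ineq_sum)
  finally show ?thesis .
qed

text \<open>The optimal \<open>\<rho>\<close> would be \<open>n / (n + 1)\<close>, which degenerates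
  for \<open>n = 0\<close>. With \<open>t = 1 / (n + 1)\<close> the chosen value gives
  \<open>\<rho> ^ n * (1 - \<rho>) = exp (- 1) * (exp t - 1)\<close>, and
  \<open>exp t - 1 \<ge> t\<close>.\<close>

lemma weight_constant:
  fixes n :: nat
  defines "\<rho> \<equiv> exp (- 1 / (real n + 1))"
  shows "1 / (\<rho> ^ n * (1 - \<rho>)) \<le> exp 1 * (real n + 1)"
proof -
  let ?t = "1 / (real n + 1)"
  have "real n * ?t = 1 - ?t" by (simp add: field_simps)
  then have "\<rho> ^ n = exp (?t - 1)"
    by (simp add: \<rho>_def flip: exp_of_nat_mult)
  then have "\<rho> ^ n * (1 - \<rho>) = exp (?t - 1) - exp (?t - 1) * exp (- ?t)"
    by (simp add: \<rho>_def algebra_simps)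
  also have "\<dots> = exp (- 1) * (exp ?t - 1)"
    by (simp add: algebra_simps flip: exp_add)
  also have "\<dots> \<ge> exp (- 1) * ?t"
  proof (rule mult_left_mono)
    show "?t \<le> exp ?t - 1" using exp_ge_add_one_self[of ?t] by linarith
  qed simp
  finally have "exp (- 1) * ?t \<le> \<rho> ^ n * (1 - \<rho>)" .
  then have "1 / (\<rho> ^ n * (1 - \<rho>)) \<le> 1 / (exp (- 1) * ?t)"
    by (intro divide_left_mono) (auto intro!: mult_pos_pos simp: \<rho>_def)
  then show ?thesis by (simp add: exp_minus field_simps)
qed

subsection \<open>The action of a homogeneous sum\<close>

context circular_family begin

text \<open>Coefficients are total functions vanishing beyond length \<open>M\<close>, so that
  \<open>\<beta> (enc True v @ y)\<close> makes sense also for words that are too long.\<close>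

definition word_span :: "'i set \<Rightarrow> 'a set" where
  "word_span J = {\<Sum>z\<in>letter_words M J. \<beta> z *\<^sub>C basis z | M \<beta>. \<forall>z. M < length z \<longrightarrow> \<beta> z = 0}"

text \<open>Splitting \<open>r\<close> as \<open>u @ rev v\<close>, the segment \<open>v\<close> is
  annihilated and \<open>u\<close> is created; terms are then collected by the resulting word
  \<open>w\<close>.\<close>

lemma mult_word_span:
  fixes J :: "'i set" and n M :: nat and \<alpha> :: "'i list \<Rightarrow> complex" and \<beta> :: "('i \<times> bool) list \<Rightarrow> complex"
  assumes J: "finite J" and \<beta>: "\<And>z. M < length z \<Longrightarrow> \<beta> z = 0"
  defines "s \<equiv> \<lambda>k u y. \<Sum>v\<in>index_words (n - k) J. \<alpha> (u @ rev v) * \<beta> (enc True v @ y)"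
  shows "(\<Sum>r\<in>index_words n J. \<alpha> r *\<^sub>C word_prod c r) * (\<Sum>z\<in>letter_words M J. \<beta> z *\<^sub>C basis z)
    = (\<Sum>w\<in>letter_words (M + n) J.
        (\<Sum>k\<le>n. if starts k False w then s k (map fst (take k w)) (drop k w) else 0) *\<^sub>C basis w)"
proof -
  let ?U = "\<lambda>k. index_words k J" and ?W = "\<lambda>M. letter_words M J"
  define B where "B k r z = (if take (n - k) z = enc True (rev (drop k r))
      then basis (enc False (take k r) @ drop (n - k) z) else 0)" for k r z
  have inner: "(\<Sum>r\<in>?U n. \<Sum>z\<in>?W M. (\<alpha> r * \<beta> z) *\<^sub>C B k r z)
      = (\<Sum>w\<in>?W (M + n). (if starts k False w then s k (map fst (take k w)) (drop k w) else 0) *\<^sub>C basis w)"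
    if k: "k \<le> n" for k
  proof -
    let ?m = "n - k"
    have "(\<Sum>r\<in>?U n. \<Sum>z\<in>?W M. (\<alpha> r * \<beta> z) *\<^sub>C B k r z)
      = (\<Sum>u\<in>?U k. \<Sum>v\<in>?U ?m. \<Sum>z\<in>?W M. (\<alpha> (u @ rev v) * \<beta> z) *\<^sub>C
          (if take ?m z = enc True v then basis (enc False u @ drop ?m z) else 0))"
      unfolding sum_index_words_split[OF k]
      by (intro sum.cong refl) (simp add: B_def index_words_def)
    also have "\<dots> = (\<Sum>u\<in>?U k. \<Sum>v\<in>?U ?m. \<Sum>y\<in>?W M.
          (\<alpha> (u @ rev v) * \<beta> (enc True v @ y)) *\<^sub>C basis (enc False u @ y))"
    proof (rule sum.cong[OF refl])
      fix u
      let ?G = "\<lambda>v y. (\<alpha> (u @ rev v) * \<beta> (enc True v @ y)) *\<^sub>C basis (enc False u @ y)"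
      let ?F = "\<lambda>v z. (\<alpha> (u @ rev v) * \<beta> z) *\<^sub>C
          (if take ?m z = enc True v then basis (enc False u @ drop ?m z) else 0)"
      \<comment> \<open>At most one \<open>v\<close> matches the starred prefix of a given
        \<open>z\<close>.\<close>
      have "(\<Sum>v\<in>?U ?m. ?F v z)
        = (if starts ?m True z then ?G (map fst (take ?m z)) (drop ?m z) else 0)"
        if z: "z \<in> ?W M" for z
      proof (cases "starts ?m True z")
        case True
        let ?v = "map fst (take ?m z)"
        have v: "?v \<in> ?U ?m"
          using True z by (fastforce simp: starts_def letter_words_def index_words_def
              dest!: in_set_takeD)
        have "(\<Sum>v\<in>?U ?m. ?F v z) = (\<Sum>v\<in>?U ?m. if v = ?v then ?F ?v z else 0)"
          using map_fst_enc by (intro sum.cong refl) auto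
        also have "\<dots> = ?F ?v z"
          using v finite_index_words[OF J] by (simp add: sum.delta)
        also have "\<dots> = ?G ?v (drop ?m z)"
          using True by (simp add: enc_starts)
        finally show ?thesis using True by simp
      next
        case False
        have "?F v z = 0" if v: "v \<in> ?U ?m" for v
        proof -
          have "take ?m z \<noteq> enc True v"
          proof
            assume eq: "take ?m z = enc True v"
            have "z = enc True v @ drop ?m z" by (simp flip: eq)
            then have "starts (length v) True z" using starts_enc by metis
            then show False using False v by (simp add: index_words_def)
          qed
          then show ?thesis by simp
        qed
        then show ?thesis using False by simp
      qed
      then have "(\<Sum>v\<in>?U ?m. \<Sum>z\<in>?W M. ?F v z)
        = (\<Sum>z\<in>?W M. if starts ?m True z then ?G (map fst (take ?m z)) (drop ?m z) else 0)"
        by (subst sum.swap) (rule sum.cong[OF refl])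
      also have "\<dots> = (\<Sum>v\<in>?U ?m. \<Sum>y\<in>?W M. ?G v y)"
      proof -
        \<comment> \<open>The cut-off to \<open>length v = ?m\<close> is what makes
          \<open>\<beta>\<close> vanish whenever \<open>?m + length y\<close> exceeds
          \<open>M\<close>, as \<open>sum_starts\<close> requires.\<close>
        define G where "G v y = (if length v = ?m then ?G v y else 0)" for v y
        have "(\<Sum>z\<in>?W M. if starts ?m True z then ?G (map fst (take ?m z)) (drop ?m z) else 0)
          = (\<Sum>z\<in>?W M. if starts ?m True z then G (map fst (take ?m z)) (drop ?m z) else 0)"
          by (intro sum.cong refl) (simp add: G_def starts_def)
        also have "\<dots> = (\<Sum>v\<in>?U ?m. \<Sum>y\<in>?W M. G v y)"
          by (rule sum_starts[OF J]) (simp_all add: G_def \<beta>)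
        also have "\<dots> = (\<Sum>v\<in>?U ?m. \<Sum>y\<in>?W M. ?G v y)"
          by (intro sum.cong refl) (simp add: G_def index_words_def)
        finally show ?thesis .
      qed
      finally show "(\<Sum>v\<in>?U ?m. \<Sum>z\<in>?W M. ?F v z) = (\<Sum>v\<in>?U ?m. \<Sum>y\<in>?W M. ?G v y)" .
    qed
    also have "\<dots> = (\<Sum>u\<in>?U k. \<Sum>y\<in>?W M. s k u y *\<^sub>C basis (enc False u @ y))"
      unfolding s_def scaleC_sum_left by (intro sum.cong refl) (rule sum.swap)
    also have "\<dots> = (\<Sum>w\<in>?W (M + n). if starts k False w
        then s k (map fst (take k w)) (drop k w) *\<^sub>C basis (enc False (map fst (take k w)) @ drop k w) else 0)"
      using k by (intro sum_starts[OF J, symmetric]) (simp_all add: s_def \<beta>)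
    also have "\<dots> = (\<Sum>w\<in>?W (M + n). (if starts k False w
        then s k (map fst (take k w)) (drop k w) else 0) *\<^sub>C basis w)"
      by (intro sum.cong refl) (simp add: enc_starts)
    finally show ?thesis .
  qed
  have "(\<Sum>r\<in>?U n. \<alpha> r *\<^sub>C word_prod c r) * (\<Sum>z\<in>?W M. \<beta> z *\<^sub>C basis z)
    = (\<Sum>r\<in>?U n. \<Sum>z\<in>?W M. (\<alpha> r * \<beta> z) *\<^sub>C (\<Sum>k\<le>n. B k r z))"
    unfolding sum_product
    by (intro sum.cong refl)
      (simp add: mult_scaleC_left mult_scaleC_right scaleC_scaleC mult.commute word_prod_basis
        index_words_def B_def cong: if_cong)
  also have "\<dots> = (\<Sum>k\<le>n. \<Sum>r\<in>?U n. \<Sum>z\<in>?W M. (\<alpha> r * \<beta> z) *\<^sub>C B k r z)"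
    unfolding scaleC_sum_right by (subst sum.swap, subst (2) sum.swap) (rule refl)
  also have "\<dots> = (\<Sum>k\<le>n. \<Sum>w\<in>?W (M + n).
      (if starts k False w then s k (map fst (take k w)) (drop k w) else 0) *\<^sub>C basis w)"
    by (intro sum.cong refl inner) simp
  also have "\<dots> = (\<Sum>w\<in>?W (M + n).
      (\<Sum>k\<le>n. if starts k False w then s k (map fst (take k w)) (drop k w) else 0) *\<^sub>C basis w)"
    unfolding scaleC_sum_left by (rule sum.swap)
  finally show ?thesis .
qed

lemma sqn_mult_word_span_le:
  assumes J: "finite J" "J \<subseteq> I" and b: "b \<in> word_span J"
  shows "sqn ((\<Sum>r\<in>index_words n J. \<alpha> r *\<^sub>C word_prod c r) * b)
    \<le> exp 1 * (real n + 1) * (\<Sum>r\<in>index_words n J. (cmod (\<alpha> r))\<^sup>2) * sqn b"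
proof -
  let ?U = "\<lambda>k. index_words k J" and ?W = "\<lambda>M. letter_words M J"
  obtain M \<beta> where b: "b = (\<Sum>z\<in>?W M. \<beta> z *\<^sub>C basis z)"
    and \<beta>: "\<And>z. M < length z \<Longrightarrow> \<beta> z = 0"
    using b by (auto simp: word_span_def)
  define \<rho> where "\<rho> = exp (- 1 / (real n + 1))"
  have \<rho>: "0 < \<rho>" "\<rho> < 1" by (simp_all add: \<rho>_def)
  have K: "1 / (\<rho> ^ n * (1 - \<rho>)) \<le> exp 1 * (real n + 1)"
    unfolding \<rho>_def by (rule weight_constant)
  define s where "s k u y = (\<Sum>v\<in>?U (n - k). \<alpha> (u @ rev v) * \<beta> (enc True v @ y))" for k u y
  define L where "L = (\<Sum>r\<in>?U n. (cmod (\<alpha> r))\<^sup>2)"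
  let ?st = "\<lambda>k w. starts k False w"
  let ?t = "\<lambda>k w. s k (map fst (take k w)) (drop k w)"
  have norm_basis: "sqn (\<Sum>z\<in>?W N. f z *\<^sub>C basis z) = (\<Sum>z\<in>?W N. (cmod (f z))\<^sup>2)" for N f
    using J by (intro sqn_sum_basis finite_letter_words) (auto simp: letter_words_def)
  \<comment> \<open>Cauchy-Schwarz over the number \<open>k\<close> of created letters, with weights
    of total at most 1.\<close>
  have pointwise: "(cmod (\<Sum>k\<le>n. if ?st k w then ?t k w else 0))\<^sup>2
      \<le> (\<Sum>k\<le>n. if ?st k w then (cmod (?t k w))\<^sup>2 / weight \<rho> k (drop k w) else 0)" for w
  proof -
    have "(\<Sum>k\<in>{k\<in>{..n}. ?st k w}. weight \<rho> k (drop k w)) \<le> 1"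
      using sum_weight_le[OF \<rho>] by (simp only: sum.inter_filter[OF finite_atMost])
    then have "(cmod (\<Sum>k\<in>{k\<in>{..n}. ?st k w}. ?t k w))\<^sup>2
        \<le> (\<Sum>k\<in>{k\<in>{..n}. ?st k w}. (cmod (?t k w))\<^sup>2 / weight \<rho> k (drop k w))"
      by (intro cmod_sum_weighted weight_pos \<rho>) simp_all
    then show ?thesis by (simp only: sum.inter_filter[OF finite_atMost])
  qed
  \<comment> \<open>Cauchy-Schwarz over the annihilated segment \<open>v\<close> separates
    \<open>\<alpha>\<close> from \<open>\<beta>\<close>. Summed over \<open>u\<close> as well, the
    \<open>\<alpha>\<close> factor is \<open>L\<close> for every \<open>k\<close>.\<close>
  have block: "(\<Sum>w\<in>?W (M + n). if ?st k w then (cmod (?t k w))\<^sup>2 / weight \<rho> k (drop k w) else 0)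
      \<le> L * (\<Sum>z\<in>?W M. if starts (n - k) True z
          then (cmod (\<beta> z))\<^sup>2 / weight \<rho> k (drop (n - k) z) else 0)"
    if k: "k \<le> n" for k
  proof -
    let ?A = "\<lambda>u. \<Sum>v\<in>?U (n - k). (cmod (\<alpha> (u @ rev v)))\<^sup>2"
    let ?B = "\<lambda>y. \<Sum>v\<in>?U (n - k). (cmod (\<beta> (enc True v @ y)))\<^sup>2"
    have "(\<Sum>w\<in>?W (M + n). if ?st k w then (cmod (?t k w))\<^sup>2 / weight \<rho> k (drop k w) else 0)
        = (\<Sum>u\<in>?U k. \<Sum>y\<in>?W M. (cmod (s k u y))\<^sup>2 / weight \<rho> k y)"
      using k by (intro sum_starts[OF J(1)]) (simp_all add: s_def \<beta>)
    also have "\<dots> \<le> (\<Sum>u\<in>?U k. \<Sum>y\<in>?W M. ?A u * ?B y / weight \<rho> k y)"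
      unfolding s_def
      by (intro sum_mono divide_right_mono cmod_sum_mult less_imp_le weight_pos \<rho>)
    also have "\<dots> = (\<Sum>u\<in>?U k. ?A u) * (\<Sum>y\<in>?W M. ?B y / weight \<rho> k y)"
      by (simp add: sum_product)
    also have "(\<Sum>u\<in>?U k. ?A u) = L"
      unfolding L_def by (rule sum_index_words_split[OF k, symmetric])
    also have "(\<Sum>y\<in>?W M. ?B y / weight \<rho> k y)
        = (\<Sum>v\<in>?U (n - k). \<Sum>y\<in>?W M. (cmod (\<beta> (enc True v @ y)))\<^sup>2 / weight \<rho> k y)"
      unfolding sum_divide_distrib by (rule sum.swap)
    also have "\<dots> = (\<Sum>z\<in>?W M. if starts (n - k) True z
          then (cmod (\<beta> (enc True (map fst (take (n - k) z)) @ drop (n - k) z)))\<^sup>2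
            / weight \<rho> k (drop (n - k) z) else 0)"
    proof -
      define G where "G v y = (if length v = n - k
        then (cmod (\<beta> (enc True v @ y)))\<^sup>2 / weight \<rho> k y else 0)" for v y
      have "(\<Sum>v\<in>?U (n - k). \<Sum>y\<in>?W M. (cmod (\<beta> (enc True v @ y)))\<^sup>2 / weight \<rho> k y)
          = (\<Sum>v\<in>?U (n - k). \<Sum>y\<in>?W M. G v y)"
        by (intro sum.cong refl) (simp add: G_def index_words_def)
      also have "\<dots> = (\<Sum>z\<in>?W M. if starts (n - k) True z
          then G (map fst (take (n - k) z)) (drop (n - k) z) else 0)"
        by (rule sum_starts[OF J(1), symmetric]) (simp_all add: G_def \<beta>)
      also have "\<dots> = (\<Sum>z\<in>?W M. if starts (n - k) True z
          then (cmod (\<beta> (enc True (map fst (take (n - k) z)) @ drop (n - k) z)))\<^sup>2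
            / weight \<rho> k (drop (n - k) z) else 0)"
        by (intro sum.cong refl) (simp add: G_def starts_def)
      finally show ?thesis .
    qed
    finally show ?thesis by (simp add: enc_starts cong: if_cong)
  qed
  have "sqn ((\<Sum>r\<in>?U n. \<alpha> r *\<^sub>C word_prod c r) * b)
      = (\<Sum>w\<in>?W (M + n). (cmod (\<Sum>k\<le>n. if ?st k w then ?t k w else 0))\<^sup>2)"
    unfolding b s_def using mult_word_span[OF J(1), where M = M and \<beta> = \<beta> and n = n and \<alpha> = \<alpha>, OF \<beta>]
    by (simp only: norm_basis)
  also have "\<dots> \<le> (\<Sum>w\<in>?W (M + n). \<Sum>k\<le>n. if ?st k w
      then (cmod (?t k w))\<^sup>2 / weight \<rho> k (drop k w) else 0)"
    by (intro sum_mono pointwise)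
  also have "\<dots> = (\<Sum>k\<le>n. \<Sum>w\<in>?W (M + n). if ?st k w
      then (cmod (?t k w))\<^sup>2 / weight \<rho> k (drop k w) else 0)"
    by (rule sum.swap)
  also have "\<dots> \<le> (\<Sum>k\<le>n. L * (\<Sum>z\<in>?W M. if starts (n - k) True z
          then (cmod (\<beta> z))\<^sup>2 / weight \<rho> k (drop (n - k) z) else 0))"
    by (intro sum_mono block) simp
  also have "\<dots> = L * (\<Sum>z\<in>?W M. \<Sum>k\<le>n. if starts (n - k) True z
          then (cmod (\<beta> z))\<^sup>2 / weight \<rho> k (drop (n - k) z) else 0)"
    unfolding sum_distrib_left[symmetric] by (subst sum.swap) (rule refl)
  \<comment> \<open>After the exchange of sums each coefficient \<open>\<beta> z\<close> carries the
    sum of inverse weights bounded above.\<close>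
  also have "\<dots> = L * (\<Sum>z\<in>?W M. (cmod (\<beta> z))\<^sup>2 * (\<Sum>k\<le>n. if starts (n - k) True z
          then 1 / weight \<rho> k (drop (n - k) z) else 0))"
    unfolding sum_distrib_left[of "(cmod _)\<^sup>2"]
    by (intro arg_cong2[where f = "(*)"] sum.cong refl) simp
  also have "\<dots> \<le> L * (\<Sum>z\<in>?W M. (cmod (\<beta> z))\<^sup>2 * (exp 1 * (real n + 1)))"
    unfolding L_def
    by (intro mult_left_mono sum_mono sum_nonneg order_trans[OF sum_inverse_weight_le[OF \<rho>] K])
      simp_all
  also have "\<dots> = exp 1 * (real n + 1) * L * sqn b"
    unfolding b norm_basis sum_distrib_right[symmetric] by (simp only: mult_ac)
  finally show ?thesis unfolding L_def .
qed

section \<open>Invariance of the word span under left multiplication by letters\<close>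

lemma word_spanI:
  assumes "finite J" "finite F" "\<And>z. z \<in> F \<Longrightarrow> set z \<subseteq> J \<times> UNIV"
  shows "(\<Sum>z\<in>F. \<beta> z *\<^sub>C basis z) \<in> word_span J"
proof -
  \<comment> \<open>The inserted 0 covers empty \<open>F\<close>.\<close>
  define M where "M = Max (insert 0 (length ` F))"
  have M: "length z \<le> M" if "z \<in> F" for z
    using that assms(2) by (auto simp: M_def)
  define \<gamma> where "\<gamma> z = (if z \<in> F then \<beta> z else 0)" for z
  have "(\<Sum>z\<in>F. \<beta> z *\<^sub>C basis z) = (\<Sum>z\<in>letter_words M J. \<gamma> z *\<^sub>C basis z)"
    using assms M
    by (intro sum.mono_neutral_cong_left finite_letter_words) (auto simp: letter_words_def \<gamma>_def)
  moreover have "\<forall>z. M < length z \<longrightarrow> \<gamma> z = 0"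
    using M by (auto simp: \<gamma>_def leD)
  ultimately show ?thesis by (auto simp: word_span_def)
qed

lemma word_span_add:
  assumes J: "finite J" and "a \<in> word_span J" "b \<in> word_span J"
  shows "a + b \<in> word_span J"
proof -
  obtain M \<beta> N \<gamma> where a: "a = (\<Sum>z\<in>letter_words M J. \<beta> z *\<^sub>C basis z)"
      "\<forall>z. M < length z \<longrightarrow> \<beta> z = 0"
    and b: "b = (\<Sum>z\<in>letter_words N J. \<gamma> z *\<^sub>C basis z)" "\<forall>z. N < length z \<longrightarrow> \<gamma> z = 0"
    using assms(2,3) by (auto simp: word_span_def)
  let ?W = "letter_words (max M N) J"
  have extend: "(\<Sum>z\<in>letter_words K J. f z *\<^sub>C basis z) = (\<Sum>z\<in>?W. f z *\<^sub>C basis z)"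
    if "K \<le> max M N" "\<forall>z. K < length z \<longrightarrow> f z = 0" for K f
  proof (rule sum.mono_neutral_left)
    show "letter_words K J \<subseteq> ?W" using that(1) by (auto simp: letter_words_def)
    show "\<forall>z\<in>?W - letter_words K J. f z *\<^sub>C basis z = 0"
      using that(2) by (auto simp: letter_words_def not_le)
  qed (rule finite_letter_words[OF J])
  have "a = (\<Sum>z\<in>?W. \<beta> z *\<^sub>C basis z)" "b = (\<Sum>z\<in>?W. \<gamma> z *\<^sub>C basis z)"
    unfolding a(1) b(1) by (rule extend, simp, rule a b)+
  then have "a + b = (\<Sum>z\<in>?W. (\<beta> z + \<gamma> z) *\<^sub>C basis z)"
    by (simp add: scaleC_add_left sum.distrib)
  then show ?thesis
    using word_spanI[OF J finite_letter_words[OF J]] by (simp add: letter_words_def)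
qed

lemma word_span_scaleC: "b \<in> word_span J \<Longrightarrow> a *\<^sub>C b \<in> word_span J"
  by (auto simp: word_span_def scaleC_sum_right scaleC_scaleC
      intro!: exI[of _ "\<lambda>z. a * _ z"])

lemma basis_in_word_span:
  assumes "finite J" "set w \<subseteq> J \<times> UNIV"
  shows "basis w \<in> word_span J"
  using word_spanI[of J "{w}" "\<lambda>_. 1"] assms by (simp add: scaleC_one)

lemma word_span_sum:
  assumes "finite J" "\<And>x. x \<in> S \<Longrightarrow> f x \<in> word_span J"
  shows "sum f S \<in> word_span J"
  using assms(2)
proof (induction S rule: infinite_finite_induct)
  case (insert x S)
  then show ?case by (simp add: word_span_add[OF assms(1)])
qed (use word_spanI[OF assms(1), of "{}"] in simp_all)

lemma letter_mult_word_span: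
  assumes J: "finite J" and l: "l \<in> J \<times> UNIV" and b: "b \<in> word_span J"
  shows "letter l * b \<in> word_span J"
proof -
  have "letter l * basis z \<in> word_span J" if z: "set z \<subseteq> J \<times> UNIV" for z
  proof -
    have "set (tl z) \<subseteq> J \<times> UNIV" using z by (cases z) auto
    then show ?thesis unfolding letter_basis
      using z l word_span_sum[OF J, of "{}"]
      by (intro word_span_add[OF J]) (auto intro!: basis_in_word_span[OF J])
  qed
  moreover obtain M \<beta> where "b = (\<Sum>z\<in>letter_words M J. \<beta> z *\<^sub>C basis z)"
    using b by (auto simp: word_span_def)
  ultimately show ?thesis
    by (simp add: sum_distrib_left mult_scaleC_right)
      (auto intro!: word_span_sum[OF J] word_span_scaleC simp: letter_words_def)
qed

lemma prod_letters_mult_word_span: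
  assumes "finite J" "set w \<subseteq> J \<times> UNIV" "b \<in> word_span J"
  shows "prod_list (map letter w) * b \<in> word_span J"
  using assms(2)
  by (induction w) (use assms letter_mult_word_span in \<open>simp_all add: mult.assoc\<close>)

subsection \<open>The strong Haagerup inequality\<close>

text \<open>The adjoints of the \<open>c_r\<close> are distinct basis vectors in starred letters.
  The adjoint is needed because \<open>norm2\<close> is computed from
  \<open>x * star x\<close>.\<close>

lemma sqn_star_sum_word_prod:
  assumes "finite J" "J \<subseteq> I"
  shows "sqn (star (\<Sum>r\<in>index_words n J. \<alpha> r *\<^sub>C word_prod c r)) = (\<Sum>r\<in>index_words n J. (cmod (\<alpha> r))\<^sup>2)"
proof -
  let ?e = "\<lambda>r. enc True (rev r)"
  have inj: "inj_on ?e (index_words n J)"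
    by (rule inj_on_inverseI[where g = "\<lambda>w. rev (map fst w)"]) simp
  have "star (\<Sum>r\<in>index_words n J. \<alpha> r *\<^sub>C word_prod c r)
      = (\<Sum>w\<in>?e ` index_words n J. cnj (\<alpha> (rev (map fst w))) *\<^sub>C basis w)"
    by (simp add: sum.reindex[OF inj] star_sum star_scaleC star_word_prod_eq_basis)
  also have "sqn \<dots> = (\<Sum>w\<in>?e ` index_words n J. (cmod (\<alpha> (rev (map fst w))))\<^sup>2)"
    using assms
    by (subst sqn_sum_basis) (auto simp: index_words_def enc_def intro!: finite_imageI finite_index_words[unfolded index_words_def])
  finally show ?thesis by (simp add: sum.reindex[OF inj])
qed

text \<open>The bound on the word span is iterated along the powers of \<open>star x * x\<close>
  starting from 1, and the resulting moment bound controls the norm.\<close>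

lemma norm_sum_word_prod_le:
  fixes n :: nat and \<alpha> :: "'i list \<Rightarrow> complex"
  assumes J: "finite J" "J \<subseteq> I"
  defines "x \<equiv> (\<Sum>r\<in>index_words n J. \<alpha> r *\<^sub>C word_prod c r)"
  shows "norm x \<le> sqrt (exp 1) * sqrt (real n + 1) * norm2 \<phi> x"
proof -
  define C where "C = exp 1 * (real n + 1) * sqn (star x)"
  have C: "0 \<le> C" by (simp add: C_def sqn_nonneg)
  have x_le: "sqn (x * b) \<le> C * sqn b" if "b \<in> word_span J" for b
    using sqn_mult_word_span_le[OF J that] sqn_star_sum_word_prod[OF J]
    by (simp add: C_def x_def)
  have x_in: "x * b \<in> word_span J" and x'_in: "star x * b \<in> word_span J"
    if b: "b \<in> word_span J" for b
  proof -
    have "word_prod c r * b \<in> word_span J" "star (word_prod c r) * b \<in> word_span J"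
      if "r \<in> index_words n J" for r
    proof -
      have "word_prod c r = prod_list (map letter (enc False r))"
        by (simp only: word_prod_eq_basis prod_letters_enc)
      moreover have "star (word_prod c r) = prod_list (map letter (enc True (rev r)))"
        by (simp only: star_word_prod_eq_basis prod_letters_enc)
      moreover have "set (enc False r) \<subseteq> J \<times> UNIV" "set (enc True (rev r)) \<subseteq> J \<times> UNIV"
        using that by (auto simp: enc_def index_words_def)
      ultimately show "word_prod c r * b \<in> word_span J" "star (word_prod c r) * b \<in> word_span J"
        using prod_letters_mult_word_span[OF J(1)] b by simp_all
    qed
    then show "x * b \<in> word_span J" "star x * b \<in> word_span J"
      by (auto simp: x_def star_sum star_scaleC sum_distrib_right mult_scaleC_left
          intro!: word_span_sum[OF J(1)] word_span_scaleC)
  qed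
  \<comment> \<open>Duality: \<open>sqn (star x * b)\<close> is the inner product of
    \<open>b\<close> with \<open>x * (star x * b)\<close>, so the bound for \<open>x\<close> carries
    over to its adjoint.\<close>
  have x'_le: "sqn (star x * b) \<le> C * sqn b" if b: "b \<in> word_span J" for b
  proof -
    let ?y = "star x * b"
    have "star ?y * ?y = star b * (x * ?y)" by (simp add: star_mult star_star mult.assoc)
    then have "(sqn ?y)\<^sup>2 = (cmod (\<phi> (star b * (x * ?y))))\<^sup>2"
      using state_square[of ?y] by simp
    also have "\<dots> \<le> sqn b * sqn (x * ?y)" by (rule cauchy_schwarz)
    also have "\<dots> \<le> sqn b * (C * sqn ?y)"
      by (intro mult_left_mono x_le x'_in b sqn_nonneg)
    finally have *: "sqn ?y * sqn ?y \<le> (C * sqn b) * sqn ?y"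
      by (simp add: power2_eq_square mult_ac)
    show ?thesis
    proof (cases "sqn ?y = 0")
      case True
      then show ?thesis using C sqn_nonneg[of b] by simp
    next
      case False
      then have "0 < sqn ?y" using sqn_nonneg[of ?y] by linarith
      then show ?thesis using * by (rule mult_right_le_imp_le[rotated])
    qed
  qed
  define h where "h = star x * x"
  \<comment> \<open>Membership in the span is proved alongside, since it permits the next
    application of the bounds.\<close>
  have pow: "h ^ m \<in> word_span J \<and> sqn (h ^ m) \<le> (C ^ m)\<^sup>2" for m
  proof (induction m)
    case 0
    have "basis [] \<in> word_span J" by (rule basis_in_word_span[OF J(1)]) simp
    then show ?case by (simp add: sqn_def state_one)
  next
    case (Suc m)
    have eq: "h ^ Suc m = star x * (x * h ^ m)" by (simp add: h_def mult.assoc)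
    have "sqn (h ^ Suc m) \<le> C * sqn (x * h ^ m)"
      unfolding eq using Suc by (intro x'_le x_in) simp
    also have "\<dots> \<le> C * (C * sqn (h ^ m))"
      using Suc C by (intro mult_left_mono x_le) simp_all
    also have "\<dots> \<le> C * (C * (C ^ m)\<^sup>2)"
      using Suc C by (intro mult_left_mono) simp_all
    finally have "sqn (h ^ Suc m) \<le> (C ^ Suc m)\<^sup>2" by (simp add: power2_eq_square mult_ac)
    moreover have "h ^ Suc m \<in> word_span J"
      unfolding eq using Suc by (intro x_in x'_in) simp
    ultimately show ?case by simp
  qed
  have "norm h \<le> C"
    using pow C by (intro norm_le_of_moments) (simp_all add: h_def star_mult star_star)
  then have "(norm x)\<^sup>2 \<le> C" by (simp add: h_def cstar_identity)
  then have "norm x \<le> sqrt C" by (rule real_le_rsqrt)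
  then show ?thesis by (simp add: C_def real_sqrt_mult norm2_eq)
qed

lemma norm_finite_sums_le:
  assumes "x \<in> finite_sums n c I"
  shows "norm x \<le> sqrt (exp 1) * sqrt (real n + 1) * norm2 \<phi> x"
proof -
  obtain F a where F: "finite F" "F \<subseteq> index_words n I"
    and x: "x = (\<Sum>w\<in>F. a w *\<^sub>C word_prod c w)"
    using assms by (auto simp: finite_sums_def)
  \<comment> \<open>Only the finitely many indices that occur matter; the missing words get
    coefficient 0.\<close>
  define J where "J = (\<Union>w\<in>F. set w)"
  have J: "finite J" "J \<subseteq> I" using F by (auto simp: J_def index_words_def)
  have "x = (\<Sum>r\<in>index_words n J. (if r \<in> F then a r else 0) *\<^sub>C word_prod c r)"
    unfolding x using F
    by (intro sum.mono_neutral_cong_left finite_index_words[OF J(1)])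
      (auto simp: index_words_def J_def)
  then show ?thesis using norm_sum_word_prod_le[OF J] by simp
qed

end

section \<open>From finite sums to the completion\<close>

lemma finite_sums_diff:
  assumes "x \<in> finite_sums n c I" "y \<in> finite_sums n c I"
  shows "x - y \<in> finite_sums n c I"
proof -
  obtain F a where F: "finite F" "F \<subseteq> index_words n I" "x = (\<Sum>w\<in>F. a w *\<^sub>C word_prod c w)"
    using assms(1) by (auto simp: finite_sums_def)
  obtain G b where G: "finite G" "G \<subseteq> index_words n I" "y = (\<Sum>w\<in>G. b w *\<^sub>C word_prod c w)"
    using assms(2) by (auto simp: finite_sums_def)
  have "x = (\<Sum>w\<in>F \<union> G. (if w \<in> F then a w else 0) *\<^sub>C word_prod c w)"
    "y = (\<Sum>w\<in>F \<union> G. (if w \<in> G then b w else 0) *\<^sub>C word_prod c w)"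
    unfolding F(3) G(3) using F(1) G(1) by (auto intro!: sum.mono_neutral_cong_left)
  then have "x - y = (\<Sum>w\<in>F \<union> G.
      ((if w \<in> F then a w else 0) - (if w \<in> G then b w else 0)) *\<^sub>C word_prod c w)"
    by (simp only: scaleC_diff_left sum_subtractf)
  then show ?thesis
    unfolding finite_sums_def mem_Collect_eq using F(1,2) G(1,2)
    by (intro exI[of _ "F \<union> G"] exI conjI) simp_all
qed

theorem theorem3p12:
  fixes \<phi> :: "'a::cstar_algebra \<Rightarrow> complex"
    and \<Lambda> :: "'a \<Rightarrow> 'h::{real_inner, complete_space}"
    and c :: "'i \<Rightarrow> 'a" and I :: "'i set" and n :: nat and T :: 'h
  assumes "faithful_state \<phi>"
    and "L2_completion \<phi> \<Lambda>"
    and "countable I"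
    and "\<And>i. i \<in> I \<Longrightarrow> circular \<phi> (c i)"
    and "star_free \<phi> I c"
    and "T \<in> particle_space \<Lambda> n c I"
  shows "\<exists>x \<in> closure (finite_sums n c I).
           \<Lambda> x = T \<and> norm x \<le> sqrt (exp 1) * sqrt (real n + 1) * norm2 \<phi> x"
proof -
  interpret circular_family \<phi> c I
    by unfold_locales (use assms in auto)
  define C where "C = sqrt (exp 1) * sqrt (real n + 1)"
  have lin: "linear \<Lambda>" and iso: "norm (\<Lambda> x) = norm2 \<phi> x" for x
    using assms(2) by (auto simp: L2_completion_def)
  have bound: "norm x \<le> C * norm (\<Lambda> x)" if "x \<in> finite_sums n c I" for x
    using norm_finite_sums_le[OF that] by (simp add: C_def iso)
  \<comment> \<open>The 2-norm is dominated by the norm, so \<open>\<Lambda>\<close> is continuous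
    for the norm.\<close>
  have "norm (\<Lambda> x) \<le> norm x" for x
    using sqn_le_norm[of "star x"] by (simp add: iso norm2_eq real_le_lsqrt)
  then have \<Lambda>: "bounded_linear \<Lambda>"
    using lin by (intro bounded_linear_intro[of _ 1]) (simp_all add: linear_add linear_scale)
  obtain a where a: "((\<lambda>w. \<Lambda> (a w *\<^sub>C word_prod c w)) has_sum T) (index_words n I)"
    using assms(6) by (auto simp: particle_space_def)
  have "T \<in> closure (\<Lambda> ` finite_sums n c I)"
    unfolding closure_approachable
  proof (intro allI impI)
    fix e :: real assume "0 < e"
    then obtain F where F: "finite F" "F \<subseteq> index_words n I"
      and d: "dist (\<Sum>w\<in>F. \<Lambda> (a w *\<^sub>C word_prod c w)) T \<le> e / 2"
      using has_sum_finite_approximation[OF a, of "e / 2"] by auto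
    have "(\<Sum>w\<in>F. a w *\<^sub>C word_prod c w) \<in> finite_sums n c I"
      using F by (auto simp: finite_sums_def)
    moreover have "(\<Sum>w\<in>F. \<Lambda> (a w *\<^sub>C word_prod c w)) = \<Lambda> (\<Sum>w\<in>F. a w *\<^sub>C word_prod c w)"
      by (simp add: linear_sum[OF lin])
    ultimately show "\<exists>y\<in>\<Lambda> ` finite_sums n c I. dist y T < e"
      using d \<open>0 < e\<close> by (intro bexI[of _ "\<Lambda> (\<Sum>w\<in>F. a w *\<^sub>C word_prod c w)"]) auto
  qed
  then obtain s where s: "\<forall>k. s k \<in> \<Lambda> ` finite_sums n c I" "s \<longlonglongrightarrow> T"
    unfolding closure_sequential by blast
  from s(1) have "\<forall>k. \<exists>x. x \<in> finite_sums n c I \<and> s k = \<Lambda> x" by blast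
  from choice[OF this] obtain y where y: "\<And>k. y k \<in> finite_sums n c I" and "s = (\<lambda>k. \<Lambda> (y k))"
    by auto
  with s(2) have lim: "(\<lambda>k. \<Lambda> (y k)) \<longlonglongrightarrow> T" by simp
  \<comment> \<open>The inequality for finite sums, applied to differences, turns Cauchy sequences
    in the 2-norm into Cauchy sequences in norm.\<close>
  have "Cauchy y"
  proof (rule metric_CauchyI)
    fix e :: real assume e: "0 < e"
    have C: "0 < C" by (simp add: C_def)
    have "Cauchy (\<lambda>k. \<Lambda> (y k))" using lim by (rule LIMSEQ_imp_Cauchy)
    then obtain N where N: "\<And>j k. N \<le> j \<Longrightarrow> N \<le> k \<Longrightarrow> dist (\<Lambda> (y j)) (\<Lambda> (y k)) < e / C"
      using metric_CauchyD[of _ "e / C"] e C by (metis divide_pos_pos)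
    have "dist (y j) (y k) < e" if "N \<le> j" "N \<le> k" for j k
    proof -
      have "norm (y j - y k) \<le> C * norm (\<Lambda> (y j - y k))"
        by (intro bound finite_sums_diff y)
      also have "\<dots> = C * dist (\<Lambda> (y j)) (\<Lambda> (y k))"
        by (simp add: dist_norm linear_diff[OF lin])
      also have "\<dots> < C * (e / C)" using N[OF that] C by (rule mult_strict_left_mono)
      finally show ?thesis using C by (simp add: dist_norm)
    qed
    then show "\<exists>N. \<forall>j\<ge>N. \<forall>k\<ge>N. dist (y j) (y k) < e" by blast
  qed
  then obtain x where x: "y \<longlonglongrightarrow> x" using Cauchy_convergent convergent_def by blast
  have \<Lambda>x: "(\<lambda>k. \<Lambda> (y k)) \<longlonglongrightarrow> \<Lambda> x"
    by (rule bounded_linear.tendsto[OF \<Lambda> x])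
  show ?thesis
  proof (intro bexI conjI)
    show "x \<in> closure (finite_sums n c I)"
      using y x by (auto simp: closure_sequential)
    show "\<Lambda> x = T" using \<Lambda>x lim by (rule LIMSEQ_unique)
    \<comment> \<open>Both sides of the bound for \<open>y k\<close> converge.\<close>
    have "norm x \<le> C * norm (\<Lambda> x)"
      by (rule LIMSEQ_le[OF tendsto_norm[OF x] tendsto_mult_left[OF tendsto_norm[OF \<Lambda>x]]])
        (use bound y in blast)
    then show "norm x \<le> sqrt (exp 1) * sqrt (real n + 1) * norm2 \<phi> x"
      by (simp add: C_def iso)
  qed
qed

end
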